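(* Let $s=(s_1,\dots,s_n)$ be a composition and $h$ an admissible height function for the DKK triangulation of $\mathcal F_{G_s}$. Then the face poset of the polyhedral complex $\mathcal P_h$ of bounded cells induced by the arrangement of tropical hypersurfaces $\{\mathcal T(F^k_t):k\in[2,n+1],\,t\in[1,s_k-1]\}$ is isomorphic to the face poset of the combinatorial $s$-permutahedron.
   Context: $s$ is a composition. Stirling $s$-permutations: words with each $i\in[n]$ occurring $s_i$ times, avoiding $121$. The $a$-block is the shortest consecutive substring containing all $a$'s. For $a<c$: $(a,c)$ is an ascent if $ac$ is a consecutive substring; $\#_w(c,a)$ = number of $c$'s before the $a$-block. $s$-weak order: $w\le w'$ iff $\#_w(c,a)\le\#_{w'}(c,a)$ for all $a<c$. For a set $A$ of ascents of $w$, $w+A$ is the Stirling $s$-permutation whose inversion numbers are the pointwise smallest transitive function $I$ (for $a<b<c$: $I(b,a)=0$ or $I(c,a)\ge I(c,b)$) with $I(c,a)\ge \#_w(c,a)+[(a,c)\in A]$. The combinatorial $s$-permutahedron has faces $(w,A)$, ordered by $(w,A)\le(w',A')$ iff $[w,w+A]\subseteq[w',w'+A']$ in the $s$-weak order. Graph $G_s$ ($s_{n+1}:=2$): vertices $v_{-1},\dots,v_n$; source-edges $e^i_1,\dots,e^i_{s_i-1}$ from $v_{-1}$ to $v_{n+1-i}$ ($i\in[1,n+1]$); bump $e^i_0$ and dip $e^i_{s_i}$ from $v_{n-i}$ to $v_{n+1-i}$ ($i\in[1,n]$). Routes are $R(k,t,\delta)=(e^k_t,e^{k-1}_{\delta_{k-1}s_{k-1}},\dots,e^1_{\delta_1s_1})$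 ($k\in[1,n+1]$, $t\in[1,s_k-1]$, $\delta\in\{0,1\}^{k-1}$). $\mathcal F_{G_s}\subset\mathbb R^E$ is the unit flow polytope (nonnegative flows with netflow $1$ at $v_{-1}$, $-1$ at $v_n$), with vertices the indicator vectors $\chi_R$ of routes. Framing: incoming edges at $v_{n+1-i}$ ordered $e^i_0\prec\dots\prec e^i_{s_i}$; outgoing edges at $v_{n+1-i}$ ordered $e^{i-1}_0\prec e^{i-1}_{s_{i-1}}$. Two routes are coherent if at each maximal common subpath from inner vertex $v_i$ to inner vertex $v_j$ their initial parts (up to $v_i$) and final parts (from $v_j$) are ordered the same way, partial routes being compared via the framing order of their edges at the vertex where they last (resp. first) diverge. The convex hulls of sets of pairwise coherent routes form the DKK triangulation of $\mathcal F_{G_s}$. A function $h$ from routes to $\mathbb R$ is an admissible height function for it if the cells of the DKK triangulation are exactly the projections to $\mathbb R^E$ of the lower faces of $\mathrm{conv}\{(\chi_R,h(R))\}$. Tropical: for $k\in[2,n+1]$, $t\in[1,s_k-1]$ and $x\in\mathbb R^n$, $F^k_t(x)=\min_{\delta\in\{0,1\}^{k-1}}\big(h(R(k,t,\delta))+\sum_{i=1}^{k-1}\delta_ix_i\big)$; $\mathcal T(F^k_t)$ is the set of $x$ where the minimum is attained at least twice. Let $M^k_t(x)$ be the set of minimizing $\delta$. The cells induced by the arrangement are the sets $C(x)=\{y\in\mathbb R^n: M^k_t(x)\subseteq M^k_t(y)\ \forall k,t\}$, $x\in\mathbb R^n$; they form a polyhedral complex covering $\mathbb R^n$. $\mathcal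 P_h$ is the subcomplex of its bounded cells, ordered by inclusion. *)

theory Defs
  imports
    "HOL-Analysis.Analysis"
    "HOL-Analysis.Finite_Function_Topology"
    "HOL-Library.Sublist"
begin

text \<open>
  A composition \<open>s = (s\<^sub>1, \<dots>, s\<^sub>n)\<close> is a list of positive natural numbers, \<open>n = length s\<close>.
  All indices below are 1-based, as in \<open>s\<^sub>i\<close>.
\<close>

definition composition :: "nat list \<Rightarrow> bool" where
  "composition s \<longleftrightarrow> (\<forall>x\<in>set s. 1 \<le> x)"

text \<open>\<open>spart s i\<close> is \<open>s\<^sub>i\<close> for \<open>1 \<le> i \<le> n + 1\<close>, with the convention \<open>s\<^sub>n\<^sub>+\<^sub>1 = 2\<close>.\<close>

definition spart :: "nat list \<Rightarrow> nat \<Rightarrow> nat" where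
  "spart s i = (s @ [2]) ! (i - 1)"


section \<open>The combinatorial \<open>s\<close>-permutahedron\<close>

definition stirling_perm :: "nat list \<Rightarrow> nat list \<Rightarrow> bool" where
  "stirling_perm s w \<longleftrightarrow>
     set w \<subseteq> {1..length s} \<and>
     (\<forall>i\<in>{1..length s}. count_list w i = spart s i) \<and>
     (\<forall>a b. a < b \<longrightarrow> \<not> subseq [a, b, a] w)"

definition ascents :: "nat list \<Rightarrow> (nat \<times> nat) set" where
  "ascents w = {(a, c). a < c \<and> sublist [a, c] w}"

text \<open>The number of occurrences of \<open>c\<close> before the \<open>a\<close>-block; the block starts at the first \<open>a\<close>.\<close>

definition inv_num :: "nat list \<Rightarrow> nat \<Rightarrow> nat \<Rightarrow> nat" where
  "inv_num w c a = count_list (takeWhile (\<lambda>x. x \<noteq> a) w) c"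

text \<open>Functions on pairs \<open>(c, a)\<close> with \<open>1 \<le> a < c \<le> n\<close>; values at other pairs are irrelevant.\<close>

definition inv_le :: "nat \<Rightarrow> (nat \<Rightarrow> nat \<Rightarrow> nat) \<Rightarrow> (nat \<Rightarrow> nat \<Rightarrow> nat) \<Rightarrow> bool" where
  "inv_le n I J \<longleftrightarrow> (\<forall>a c. 1 \<le> a \<and> a < c \<and> c \<le> n \<longrightarrow> I c a \<le> J c a)"

definition inv_transitive :: "nat \<Rightarrow> (nat \<Rightarrow> nat \<Rightarrow> nat) \<Rightarrow> bool" where
  "inv_transitive n I \<longleftrightarrow>
     (\<forall>a b c. 1 \<le> a \<and> a < b \<and> b < c \<and> c \<le> n \<longrightarrow> I b a = 0 \<or> I c b \<le> I c a)"

definition s_weak_le :: "nat list \<Rightarrow> nat list \<Rightarrow> nat list \<Rightarrow> bool" where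
  "s_weak_le s w w' \<longleftrightarrow> inv_le (length s) (inv_num w) (inv_num w')"

definition s_interval :: "nat list \<Rightarrow> nat list \<Rightarrow> nat list \<Rightarrow> nat list set" where
  "s_interval s w w' = {u. stirling_perm s u \<and> s_weak_le s w u \<and> s_weak_le s u w'}"

definition is_smallest_transitive_above ::
    "nat \<Rightarrow> (nat \<Rightarrow> nat \<Rightarrow> nat) \<Rightarrow> (nat \<Rightarrow> nat \<Rightarrow> nat) \<Rightarrow> bool" where
  "is_smallest_transitive_above n L I \<longleftrightarrow>
     inv_transitive n I \<and> inv_le n L I \<and>
     (\<forall>J. inv_transitive n J \<and> inv_le n L J \<longrightarrow> inv_le n I J)"

text \<open>The Stirling \<open>s\<close>-permutation \<open>w + A\<close>.\<close>

definition add_ascents :: "nat list \<Rightarrow> nat list \<Rightarrow> (nat \<times> nat) set \<Rightarrow> nat list" where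
  "add_ascents s w A = (THE w'. stirling_perm s w' \<and>
     is_smallest_transitive_above (length s)
       (\<lambda>c a. inv_num w c a + (if (a, c) \<in> A then 1 else 0)) (inv_num w'))"

definition perm_faces :: "nat list \<Rightarrow> (nat list \<times> (nat \<times> nat) set) set" where
  "perm_faces s = {(w, A). stirling_perm s w \<and> A \<subseteq> ascents w}"

fun perm_face_le ::
    "nat list \<Rightarrow> nat list \<times> (nat \<times> nat) set \<Rightarrow> nat list \<times> (nat \<times> nat) set \<Rightarrow> bool" where
  "perm_face_le s (w, A) (w', A') \<longleftrightarrow>
     s_interval s w (add_ascents s w A) \<subseteq> s_interval s w' (add_ascents s w' A')"


section \<open>The graph \<open>G\<^sub>s\<close>, its framing and the DKK triangulation\<close>

text \<open>The pair \<open>(i, t)\<close> is the edge \<open>e\<^sup>i\<^sub>t\<close>; the integer \<open>j\<close> is the vertex \<open>v\<^sub>j\<close>, \<open>-1 \<le> j \<le> n\<close>.\<close>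

type_synonym edge = "nat \<times> nat"

fun edge_src :: "nat list \<Rightarrow> edge \<Rightarrow> int" where
  "edge_src s (i, t) =
     (if 1 \<le> t \<and> t \<le> spart s i - 1 then - 1 else int (length s) - int i)"

fun edge_tgt :: "nat list \<Rightarrow> edge \<Rightarrow> int" where
  "edge_tgt s (i, t) = int (length s) + 1 - int i"

definition deltas :: "nat \<Rightarrow> (nat \<Rightarrow> nat) set" where
  "deltas k = {1..<k} \<rightarrow>\<^sub>E {0, 1}"

text \<open>The route \<open>R(k, t, \<delta>)\<close> as the list of its consecutive edges, from \<open>v\<^sub>-\<^sub>1\<close> to \<open>v\<^sub>n\<close>.\<close>

definition route :: "nat list \<Rightarrow> nat \<Rightarrow> nat \<Rightarrow> (nat \<Rightarrow> nat) \<Rightarrow> edge list" where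
  "route s k t \<delta> = (k, t) # map (\<lambda>i. (i, \<delta> i * spart s i)) (rev [1..<k])"

definition routes :: "nat list \<Rightarrow> edge list set" where
  "routes s = {route s k t \<delta> | k t \<delta>.
     1 \<le> k \<and> k \<le> length s + 1 \<and> 1 \<le> t \<and> t \<le> spart s k - 1 \<and> \<delta> \<in> deltas k}"

definition in_less :: "nat list \<Rightarrow> edge \<Rightarrow> edge \<Rightarrow> bool" where
  "in_less s e f \<longleftrightarrow> edge_tgt s e = edge_tgt s f \<and> snd e < snd f"

definition out_less :: "nat list \<Rightarrow> edge \<Rightarrow> edge \<Rightarrow> bool" where
  "out_less s e f \<longleftrightarrow> edge_src s e = edge_src s f \<and> snd e < snd f"

text \<open>
  The list \<open>m\<close> (possibly empty: a single common vertex) is a maximal common subpath of \<open>P\<close> and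
  \<open>Q\<close>, preceded by the initial parts \<open>p1\<close>, \<open>q1\<close> and followed by the final parts \<open>p2\<close>, \<open>q2\<close>.
  Its end vertices are inner vertices iff these parts are nonempty. By maximality the initial
  parts last diverge at the first vertex of \<open>m\<close>, i.e. they are compared by their last edges, and
  the final parts first diverge at the last vertex of \<open>m\<close>, i.e. they are compared by their first
  edges.
\<close>

definition coherent :: "nat list \<Rightarrow> edge list \<Rightarrow> edge list \<Rightarrow> bool" where
  "coherent s P Q \<longleftrightarrow>
     (\<forall>p1 q1 m p2 q2.
        P = p1 @ m @ p2 \<and> Q = q1 @ m @ q2 \<and>
        p1 \<noteq> [] \<and> q1 \<noteq> [] \<and> p2 \<noteq> [] \<and> q2 \<noteq> [] \<and>
        edge_tgt s (last p1) = edge_tgt s (last q1) \<and>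
        last p1 \<noteq> last q1 \<and> hd p2 \<noteq> hd q2 \<longrightarrow>
        (in_less s (last p1) (last q1) \<longleftrightarrow> out_less s (hd p2) (hd q2)))"

text \<open>
  Vectors of \<open>\<real>\<^sup>E\<close> (and, below, of \<open>\<real>\<^sup>n\<close>) are finitely supported functions, which form
  a real normed vector space.
\<close>

definition route_vec :: "edge list \<Rightarrow> edge \<Rightarrow>\<^sub>0 real" where
  "route_vec R = (\<Sum>e\<in>set R. Poly_Mapping.single e 1)"

definition dkk_cells :: "nat list \<Rightarrow> (edge \<Rightarrow>\<^sub>0 real) set set" where
  "dkk_cells s = {convex hull (route_vec ` K) | K.
     K \<subseteq> routes s \<and> K \<noteq> {} \<and> (\<forall>P\<in>K. \<forall>Q\<in>K. coherent s P Q)}"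

definition lifted_polytope ::
    "nat list \<Rightarrow> (edge list \<Rightarrow> real) \<Rightarrow> ((edge \<Rightarrow>\<^sub>0 real) \<times> real) set" where
  "lifted_polytope s h = convex hull ((\<lambda>R. (route_vec R, h R)) ` routes s)"

text \<open>
  Lower faces of a polytope: the faces minimizing a linear functional with positive last
  coefficient, normalized to 1. The empty face is excluded, in accordance with \<open>dkk_cells\<close>.
\<close>

definition lower_faces :: "('a::real_vector \<times> real) set \<Rightarrow> ('a \<times> real) set set" where
  "lower_faces P = {F. F \<noteq> {} \<and> (\<exists>\<phi> :: 'a \<Rightarrow> real. linear \<phi> \<and>
     F = {p \<in> P. \<forall>q\<in>P. \<phi> (fst p) + snd p \<le> \<phi> (fst q) + snd q})}"

definition admissible_height :: "nat list \<Rightarrow> (edge list \<Rightarrow> real) \<Rightarrow> bool" where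
  "admissible_height s h \<longleftrightarrow> dkk_cells s = (\<lambda>F. fst ` F) ` lower_faces (lifted_polytope s h)"


section \<open>The tropical arrangement\<close>

definition Rn :: "nat \<Rightarrow> (nat \<Rightarrow>\<^sub>0 real) set" where
  "Rn n = {x. Poly_Mapping.keys x \<subseteq> {1..n}}"

definition trop_term ::
    "nat list \<Rightarrow> (edge list \<Rightarrow> real) \<Rightarrow> nat \<Rightarrow> nat \<Rightarrow> (nat \<Rightarrow>\<^sub>0 real) \<Rightarrow> (nat \<Rightarrow> nat) \<Rightarrow> real" where
  "trop_term s h k t x \<delta> =
     h (route s k t \<delta>) + (\<Sum>i\<in>{1..<k}. real (\<delta> i) * Poly_Mapping.lookup x i)"

definition trop_poly ::
    "nat list \<Rightarrow> (edge list \<Rightarrow> real) \<Rightarrow> nat \<Rightarrow> nat \<Rightarrow> (nat \<Rightarrow>\<^sub>0 real) \<Rightarrow> real" where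
  "trop_poly s h k t x = Min (trop_term s h k t x ` deltas k)"

definition trop_minimizers ::
    "nat list \<Rightarrow> (edge list \<Rightarrow> real) \<Rightarrow> nat \<Rightarrow> nat \<Rightarrow> (nat \<Rightarrow>\<^sub>0 real) \<Rightarrow> (nat \<Rightarrow> nat) set" where
  "trop_minimizers s h k t x = {\<delta> \<in> deltas k. trop_term s h k t x \<delta> = trop_poly s h k t x}"

text \<open>
  The cell containing \<open>x\<close> in its relative interior, for the arrangement of the tropical
  hypersurfaces of all \<open>F\<^sup>k\<^sub>t\<close>; the hypersurface of \<open>F\<^sup>k\<^sub>t\<close> is the locus where
  \<open>trop_minimizers s h k t\<close> has at least two elements.
\<close>

definition trop_cell ::
    "nat list \<Rightarrow> (edge list \<Rightarrow> real) \<Rightarrow> (nat \<Rightarrow>\<^sub>0 real) \<Rightarrow> (nat \<Rightarrow>\<^sub>0 real) set" where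
  "trop_cell s h x = {y \<in> Rn (length s).
     \<forall>k t. 2 \<le> k \<and> k \<le> length s + 1 \<and> 1 \<le> t \<and> t \<le> spart s k - 1 \<longrightarrow>
       trop_minimizers s h k t x \<subseteq> trop_minimizers s h k t y}"

text \<open>The cells of the complex \<open>\<P>\<^sub>h\<close>.\<close>

definition bounded_cells ::
    "nat list \<Rightarrow> (edge list \<Rightarrow> real) \<Rightarrow> (nat \<Rightarrow>\<^sub>0 real) set set" where
  "bounded_cells s h = {C \<in> trop_cell s h ` Rn (length s). bounded C}"


section \<open>Isomorphism of posets\<close>

definition poset_isomorphic ::
    "'a set \<Rightarrow> ('a \<Rightarrow> 'a \<Rightarrow> bool) \<Rightarrow> 'b set \<Rightarrow> ('b \<Rightarrow> 'b \<Rightarrow> bool) \<Rightarrow> bool" where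
  "poset_isomorphic A leA B leB \<longleftrightarrow>
     (\<exists>f. bij_betw f A B \<and> (\<forall>x\<in>A. \<forall>y\<in>A. leA x y \<longleftrightarrow> leB (f x) (f y)))"

end

theory Submission
  imports Defs
begin

text \<open>
  A route is a vector \<open>(r\<^sub>1, \<dots>, r\<^sub>k)\<close> with \<open>0 < r\<^sub>k < s\<^sub>k\<close> and \<open>r\<^sub>i \<in> {0, s\<^sub>i}\<close> for \<open>i < k\<close>, and two
  routes are coherent iff they are comparable componentwise on their common indices. By the Cayley
  trick, points of the arrangement correspond to lower faces meeting every source edge, so cells
  correspond, with inclusion reversed, to cliques containing a route through every source edge; a
  cell is bounded iff every bump and every dip is used as well.

  For such a clique \<open>K\<close> put \<open>lo c a = max {r\<^sub>c | r \<in> K, r\<^sub>a = 0}\<close> and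
  \<open>hi c a = min {r\<^sub>c | r \<in> K, r\<^sub>a = s\<^sub>a}\<close>. Both are inversion functions of Stirling permutations
  \<open>w\<close> and \<open>w'\<close>, they differ by at most one,
    and they determine \<open>K\<close>. The routes of \<open>K\<close> are count
  vectors of prefixes of \<open>w\<close>,
    and only prefixes cut at ascents can be missing; the missing ascents
  form the set \<open>A\<close> with \<open>w' = w + A\<close>,
    and inclusion of cliques becomes reverse inclusion of the
  intervals \<open>[w, w']\<close>.
\<close>

section \<open>Stirling words and their prefixes\<close>

text \<open>Two obstacles shape the argument. A route entering at \<open>k\<close> records nothing
  about letters above \<open>k\<close>, so several prefixes may agree with one route, and a clique
  is not simply a set of prefixes of a word. Prefixes are therefore reconstructed from partial count
  vectors (\<open>fits_inv\<close>), and a cut is recognized by the counts of only two letters, the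
  one before it and the one after it (\<open>prefix_eqI\<close>). Moreover, admissibility compares
  families of point sets, not families of route sets; to read off routes one needs that each
  \<open>route_vec R\<close> is a vertex and has only one lift. The condition that every source edge
  is met is what keeps \<open>hi\<close> within one of \<open>lo\<close>: a value strictly between
  them would itself be a source edge at \<open>c\<close>, and a route through it takes the bump or
  the dip at \<open>a\<close>. That \<open>hi\<close> is the smallest transitive function above the
  raised \<open>lo\<close> is shown by an induction along the word from its right end.\<close>

definition stirling_on :: "nat set \<Rightarrow> (nat \<Rightarrow> nat) \<Rightarrow> nat list \<Rightarrow> bool" where
  "stirling_on S m w \<longleftrightarrow> set w \<subseteq> S \<and> (\<forall>i\<in>S. count_list w i = m i) \<and>
     (\<forall>a b. a < b \<longrightarrow> \<not> subseq [a, b, a] w)"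

text \<open>The local conditions that make \<open>v\<close> the count vector of a prefix: while
  \<open>a\<close> is not exhausted, at most the \<open>I c a\<close> copies of \<open>c\<close>
  before its block have been read; once \<open>a\<close> has begun, all of these have been read. The
  index set may be smaller than the alphabet, as is needed for routes that see only the letters up
  to \<open>k\<close>.\<close>

definition fits_inv :: "nat set \<Rightarrow> (nat \<Rightarrow> nat) \<Rightarrow> (nat \<Rightarrow> nat \<Rightarrow> nat) \<Rightarrow> (nat \<Rightarrow> nat) \<Rightarrow> bool" where
  "fits_inv S m I v \<longleftrightarrow> (\<forall>a\<in>S. \<forall>c\<in>S. a < c \<longrightarrow>
     (v a < m a \<longrightarrow> v c \<le> I c a) \<and> (0 < v a \<longrightarrow> I c a \<le> v c))"

lemma stirling_perm_iff: "stirling_perm s w \<longleftrightarrow> stirling_on {1..length s} (spart s) w"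
  by (simp add: stirling_perm_def stirling_on_def)

lemma no_larger_between:
  assumes "stirling_on S m (u @ x @ v)" "a \<in> set u" "a \<in> set v" "a < b"
  shows "b \<notin> set x"
proof
  assume "b \<in> set x"
  then have "subseq ([a] @ [b] @ [a]) (u @ x @ v)"
    using assms(2,3) by (intro list_emb_append_mono) (simp_all add: subseq_singleton_left)
  then show False
    using assms(1,4) by (auto simp: stirling_on_def)
qed

lemma count_prefix_le:
  assumes "stirling_on S m (u @ v)" "i \<in> S"
  shows "count_list u i \<le> m i"
  using assms by (fastforce simp: stirling_on_def)

text \<open>If \<open>a\<close> does not occur in \<open>u\<close>, all of \<open>u\<close> precedes
  its block. If it does, the block is still open at the cut, and a \<open>c\<close> inside it would
  create the pattern \<open>a c a\<close>.\<close>

lemma count_le_inv_num: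
  assumes w: "stirling_on S m (u @ v)" and "a \<in> S" "a < c" "count_list u a < m a"
  shows "count_list u c \<le> inv_num (u @ v) c a"
proof (cases "a \<in> set u")
  case False
  then have "takeWhile (\<lambda>x. x \<noteq> a) (u @ v) = u @ takeWhile (\<lambda>x. x \<noteq> a) v"
    by (intro takeWhile_append2) auto
  then show ?thesis by (simp add: inv_num_def)
next
  case True
  then obtain u1 u2 where u: "u = u1 @ a # u2" "a \<notin> set u1"
    by (meson split_list_first)
  have "count_list (u @ v) a = m a"
    using w \<open>a \<in> S\<close> by (simp add: stirling_on_def)
  then have "a \<in> set v"
    using assms(4) by (metis add.right_neutral count_list_append count_notin less_irrefl)
  then have "c \<notin> set u2"
    using no_larger_between[of S m "u1 @ [a]" u2 v a c] w u \<open>a < c\<close> by auto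
  moreover have "takeWhile (\<lambda>x. x \<noteq> a) (u @ v) = u1"
    using u by (auto simp: takeWhile_append)
  ultimately show ?thesis
    using u \<open>a < c\<close> by (simp add: inv_num_def)
qed

lemma inv_num_le_count:
  assumes "0 < count_list u a"
  shows "inv_num (u @ v) c a \<le> count_list u c"
proof -
  have "a \<in> set u" using assms by (metis count_notin less_irrefl)
  then have "takeWhile (\<lambda>x. x \<noteq> a) (u @ v) = takeWhile (\<lambda>x. x \<noteq> a) u"
    by (auto intro: takeWhile_append1)
  moreover have "u = takeWhile (\<lambda>x. x \<noteq> a) u @ dropWhile (\<lambda>x. x \<noteq> a) u" by simp
  ultimately show ?thesis
    unfolding inv_num_def by (metis count_list_append le_add1)
qed

lemma inv_num_next:
  assumes w: "stirling_on S m (u @ a # v)" and "a \<in> S" "a < c"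
  shows "inv_num (u @ a # v) c a = count_list u c"
proof (rule antisym)
  show "inv_num (u @ a # v) c a \<le> count_list u c"
    using inv_num_le_count[of "u @ [a]" a v c] \<open>a < c\<close> by simp
  have "count_list (u @ a # v) a = m a"
    using w \<open>a \<in> S\<close> unfolding stirling_on_def by blast
  then have "count_list u a < m a" by simp
  then show "count_list u c \<le> inv_num (u @ a # v) c a"
    using count_le_inv_num assms by blast
qed

lemma inv_num_last:
  assumes w: "stirling_on S m (u @ v)" and "u \<noteq> []" "last u = a" "a \<in> S" "a < c"
  shows "inv_num (u @ v) c a = count_list u c"
proof -
  obtain u' where u: "u = u' @ [a]"
    using assms(2,3) by (cases u rule: rev_cases) auto
  then show ?thesis
    using inv_num_next[of S m u' a v c] assms by simp
qed

text \<open>Take a longest prefix whose counts stay below \<open>v\<close> on \<open>T\<close>.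
  Letters outside \<open>T\<close> never block its growth, so if some \<open>y\<close> is still
  short, the next letter \<open>z\<close> lies in \<open>T\<close> and has already reached
  \<open>v z\<close>. If \<open>z < y\<close>, then \<open>z\<close> is unfinished and
  \<open>fits_inv\<close> bounds \<open>v y\<close> by the copies of \<open>y\<close> already read.
  If \<open>y < z\<close>, the unfinished \<open>y\<close> forces \<open>inv_num w z y\<close> above
  \<open>v z\<close>, while \<open>fits_inv\<close> gives the opposite.\<close>

lemma fits_inv_is_prefix:
  assumes w: "stirling_on S m w" and T: "T \<subseteq> S"
    and v: "\<And>i. i \<in> T \<Longrightarrow> v i \<le> m i" "fits_inv T m (inv_num w) v"
  obtains u x where "w = u @ x" "\<And>i. i \<in> T \<Longrightarrow> count_list u i = v i"
proof -
  define P where "P u \<longleftrightarrow> prefix u w \<and> (\<forall>i\<in>T. count_list u i \<le> v i)" for u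
  have "P []" by (simp add: P_def)
  moreover have "\<forall>u. P u \<longrightarrow> length u \<le> length w"
    by (auto simp: P_def prefix_length_le)
  ultimately obtain u where u: "P u"
    and max: "\<And>u'. P u' \<Longrightarrow> length u' \<le> length u"
    using ex_has_greatest_nat[of P "[]" length "Suc (length w)"] by (auto simp: le_imp_less_Suc)
  obtain x where x: "w = u @ x" using u by (auto simp: P_def prefix_def)
  have "count_list u y = v y" if y: "y \<in> T" for y
  proof (rule ccontr)
    assume "count_list u y \<noteq> v y"
    with u y have less: "count_list u y < v y" by (force simp: P_def)
    have yS: "y \<in> S" using y T by auto
    have "count_list u y < count_list w y"
      using less v(1)[OF y] w yS by (auto simp: stirling_on_def)
    then obtain z x' where x': "x = z # x'"
      using x by (cases x) auto
    have "\<not> P (u @ [z])" using max[of "u @ [z]"] by auto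
    then have z: "z \<in> T" "count_list u z = v z"
      using u x x' by (force simp: P_def split: if_splits)+
    have zS: "z \<in> S" using z T by auto
    have w': "stirling_on S m (u @ z # x')" "stirling_on S m ((u @ [z]) @ x')" "w = u @ z # x'"
      using w x x' by auto
    have "count_list w z = m z" using w zS by (simp add: stirling_on_def)
    then have zm: "v z < m z" using z w' by simp
    have "y \<noteq> z" using less z by auto
    then consider "z < y" | "y < z" by linarith
    then show False
    proof cases
      case 1
      then have "v y \<le> inv_num w y z"
        using v(2) y z zm by (auto simp: fits_inv_def)
      then show False
        using inv_num_next[OF w'(1) zS 1] w'(3) less by simp
    next
      case 2
      have "inv_num w z y \<le> v z"
        using v(2) y z less 2 by (auto simp: fits_inv_def)
      moreover have "count_list (u @ [z]) z \<le> inv_num w z y"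
        using count_le_inv_num[OF w'(2) yS 2] less v(1)[OF y] w'(3) 2 by auto
      ultimately show False using z by simp
    qed
  qed
  with x that show thesis by blast
qed

lemma common_prefix_cases:
  assumes "length w = length w'" "w \<noteq> w'"
  obtains u x y v v' where "w = u @ x # v" "w' = u @ y # v'" "x \<noteq> y"
  using assms
proof (induction w w' arbitrary: thesis rule: list_induct2)
  case (Cons a w b w')
  show ?case
  proof (cases "a = b")
    case True
    show ?thesis
    proof (rule Cons.IH)
      show "w \<noteq> w'" using Cons.prems(2) True by simp
      show ?thesis if "w = u @ x # v" "w' = u @ y # v'" "x \<noteq> y" for u x y v v'
        using Cons.prems(1)[of "a # u" x v y v'] that True by simp
    qed
  next
    case False
    then show ?thesis using Cons.prems(1)[of "[]"] by simp
  qed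
qed auto

text \<open>Let \<open>x\<close> be the smaller of the two letters at the first difference. The word
  that reads \<open>x\<close> there has only the \<open>y\<close>s of the common prefix before its
  \<open>x\<close>-block; in the other word one more \<open>y\<close> is read before
  \<open>x\<close> is exhausted, so its inversion number is larger.\<close>

lemma stirling_on_eqI:
  assumes "finite S" and w: "stirling_on S m w" and w': "stirling_on S m w'"
    and I: "\<And>a c. a \<in> S \<Longrightarrow> c \<in> S \<Longrightarrow> a < c \<Longrightarrow> inv_num w c a = inv_num w' c a"
  shows "w = w'"
proof (rule ccontr)
  assume "w \<noteq> w'"
  have "length w = length w'"
    using sum_count_set[of w S] sum_count_set[of w' S] assms
    by (metis (no_types, lifting) stirling_on_def sum.cong)
  obtain u x y v v' where d: "w = u @ x # v" "w' = u @ y # v'" "x \<noteq> y"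
    by (rule common_prefix_cases[OF \<open>length w = length w'\<close> \<open>w \<noteq> w'\<close>])
  have S: "x \<in> S" "y \<in> S" using w w' d by (auto simp: stirling_on_def)
  have False if "stirling_on S m (u @ x # v)" "stirling_on S m (u @ y # v')" "x < y" "x \<in> S"
    "y \<in> S"
      "inv_num (u @ x # v) y x = inv_num (u @ y # v') y x" for x y v v'
  proof -
    have "inv_num (u @ x # v) y x = count_list u y"
      using inv_num_next that by blast
    have "count_list (u @ x # v) x = m x"
      using that(1,4) unfolding stirling_on_def by blast
    then have "count_list (u @ [y]) x < m x" using that by simp
    then have "count_list (u @ [y]) y \<le> inv_num ((u @ [y]) @ v') y x"
      using that by (intro count_le_inv_num[of S m]) auto
    then show False using that \<open>inv_num (u @ x # v) y x = count_list u y\<close> by simp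
  qed
  from this[of x v y v'] this[of y v' x v] show False
    using d w w' S I[of x y] I[of y x] by (cases "x < y") auto
qed

text \<open>The copies of the new smallest letter form one contiguous block, so nothing stands
  between two of them; deleting the block turns any other forbidden pattern into one of the old
  word.\<close>

lemma stirling_on_insert_min:
  assumes w: "stirling_on S m (p @ q)" and a: "\<And>i. i \<in> S \<Longrightarrow> a < i"
    and m: "1 \<le> m a"
  defines "w' \<equiv> p @ replicate (m a) a @ q"
  shows "stirling_on (insert a S) m w'"
    and "inv_num w' c a = count_list p c"
    and "b \<in> S \<Longrightarrow> c \<in> S \<Longrightarrow> inv_num w' c b = inv_num (p @ q) c b"
proof -
  have aS: "a \<notin> S" using a by blast
  have S: "set p \<subseteq> S" "set q \<subseteq> S" using w by (simp_all add: stirling_on_def)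
  then have pq: "a \<notin> set p" "a \<notin> set q" using aS by auto
  have fil: "filter (\<lambda>x. x \<noteq> a) w' = p @ q"
  proof -
    have "filter (\<lambda>x. x \<noteq> a) p = p" "filter (\<lambda>x. x \<noteq> a) q = q"
      using pq by (auto simp: filter_id_conv)
    then show ?thesis by (simp add: w'_def)
  qed
  have cr: "count_list (replicate k a) i = (if i = a then k else 0)" for k i
    by (induction k) auto
  have False if ij: "i < j" and sub: "subseq [i, j, i] w'" for i j
  proof (cases "i = a")
    case False
    have "i \<in> set w'" "j \<in> set w'"
      using list_emb_set[OF sub, of i] list_emb_set[OF sub, of j] by auto
    then have "i \<in> insert a S" using S by (auto simp: w'_def split: if_splits)
    then have "a \<le> i" using a[of i] by auto
    then have "subseq (filter (\<lambda>x. x \<noteq> a) [i, j, i]) (filter (\<lambda>x. x \<noteq> a) w')"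
      using sub by (intro subseq_filter)
    then have "subseq [i, j, i] (p @ q)" using fil \<open>a \<le> i\<close> ij False by simp
    then show False using w ij unfolding stirling_on_def by blast
  next
    case True
    have 1: "subseq [a, j, a] (replicate (m a) a @ q)"
    proof -
      have "subseq ([a, j, a]) (p @ replicate (m a) a @ q)" using sub True by (simp add: w'_def)
      then show ?thesis using pq(1)
        by (induction p) (auto split: if_splits)
    qed
    have 2: "subseq [j, a] (replicate k a @ q) \<Longrightarrow> False" for k
    proof (induction k)
      case 0
      then have "a \<in> set q" using list_emb_set[of "(=)" "[j, a]" q a] by auto
      then show ?case using pq by simp
    next
      case (Suc k)
      then show ?case using ij True by (simp split: if_splits)
    qed
    show False using 1 m 2 by (cases "m a") auto
  qed
  moreover have "\<forall>i\<in>insert a S. count_list w' i = m i"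
    using w aS pq by (auto simp: w'_def cr stirling_on_def)
  ultimately show "stirling_on (insert a S) m w'"
    using w by (auto simp: stirling_on_def w'_def)
  show "inv_num w' c a = count_list p c"
  proof -
    have "takeWhile (\<lambda>x. x \<noteq> a) p = p" using pq(1)
      by (auto simp: takeWhile_eq_all_conv)
    then show ?thesis
      using pq(1) m unfolding inv_num_def w'_def by (cases "m a") (auto simp: takeWhile_tail)
  qed
  show "inv_num w' c b = inv_num (p @ q) c b" if "b \<in> S" "c \<in> S"
  proof -
    have "b \<noteq> a" "c \<noteq> a" using that aS by auto
    then show ?thesis
      unfolding inv_num_def w'_def
      by (cases "b \<in> set p") (auto simp: takeWhile_append cr)
  qed
qed

text \<open>Letters are added in decreasing order, which is why \<open>stirling_on\<close> allows an
  arbitrary letter set. The block of the new smallest \<open>a\<close> has to follow a prefix with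
  \<open>I c a\<close> copies of each \<open>c\<close>. The last two hypotheses, transitivity and
  planarity, say exactly that this vector satisfies \<open>fits_inv\<close> for the word built so
  far.\<close>

lemma stirling_on_exists:
  assumes "finite S" "\<And>i. i \<in> S \<Longrightarrow> 1 \<le> m i"
    and "\<And>a c. a \<in> S \<Longrightarrow> c \<in> S \<Longrightarrow> a < c \<Longrightarrow> I c a \<le> m c"
    and "\<And>a b c. a \<in> S \<Longrightarrow> b \<in> S \<Longrightarrow> c \<in> S \<Longrightarrow> a < b \<Longrightarrow> b < c \<Longrightarrow> I b a = 0 \<or> I c b \<le> I c a"
    and "\<And>a b c. a \<in> S \<Longrightarrow> b \<in> S \<Longrightarrow> c \<in> S \<Longrightarrow> a < b \<Longrightarrow> b < c \<Longrightarrow> I b a = m b \<or> I c a \<le> I c b"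
  shows "\<exists>w. stirling_on S m w \<and> (\<forall>a\<in>S. \<forall>c\<in>S. a < c \<longrightarrow> inv_num w c a = I c a)"
  using assms
proof (induction rule: finite_linorder_min_induct)
  case empty
  then show ?case by (intro exI[of _ "[]"]) (auto simp: stirling_on_def)
next
  case (insert a S)
  have "\<exists>w. stirling_on S m w \<and> (\<forall>a\<in>S. \<forall>c\<in>S. a < c \<longrightarrow> inv_num w c a = I c a)"
    by (rule insert.IH; rule insert.prems; simp)
  then obtain w
    where w: "stirling_on S m w"
      "\<forall>a\<in>S. \<forall>c\<in>S. a < c \<longrightarrow> inv_num w c a = I c a"
    by blast
  have "fits_inv S m (inv_num w) (\<lambda>c. I c a)"
    unfolding fits_inv_def
  proof (intro ballI impI conjI)
    fix b c assume bc: "b \<in> S" "c \<in> S" "b < c"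
    have ab: "a < b" using insert.hyps bc by blast
    have I: "inv_num w c b = I c b" using w bc by simp
    show "I c a \<le> inv_num w c b" if "I b a < m b"
      using insert.prems(4)[of a b c] bc ab that I by auto
    show "inv_num w c b \<le> I c a" if "0 < I b a"
      using insert.prems(3)[of a b c] bc ab that I by auto
  qed
  moreover have "I c a \<le> m c" if "c \<in> S" for c
    using insert.prems(2)[of a c] insert.hyps that by blast
  ultimately obtain p q
    where pq: "w = p @ q" "\<And>c. c \<in> S \<Longrightarrow> count_list p c = I c a"
    using fits_inv_is_prefix[OF w(1) subset_refl] by metis
  define w' where "w' = p @ replicate (m a) a @ q"
  have pq': "stirling_on S m (p @ q)" using w pq by simp
  have "stirling_on (insert a S) m w'"
    unfolding w'_def by (rule stirling_on_insert_min[OF pq']) (use insert in auto)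
  moreover have "inv_num w' c b = I c b" if "b \<in> insert a S" "c \<in> insert a S" "b < c"
    for b c
  proof -
    have c: "c \<in> S" using that insert.hyps by force
    show ?thesis
    proof (cases "b = a")
      case True
      have "inv_num w' c a = count_list p c"
        unfolding w'_def by (rule stirling_on_insert_min(2)[OF pq']) (use insert in auto)
      then show ?thesis using True pq(2) c by simp
    next
      case False
      then have "inv_num w' c b = inv_num (p @ q) c b"
        unfolding w'_def using that c
          by (intro stirling_on_insert_min(3)[OF pq']) (use insert in auto)
      then show ?thesis using w(2) pq(1) that c False by auto
    qed
  qed
  ultimately show ?case by blast
qed

section \<open>Interior cliques of routes\<close>

locale multiplicities =
  fixes n :: nat and m :: "nat \<Rightarrow> nat"
  assumes m_pos: "1 \<le> i \<Longrightarrow> i \<le> n \<Longrightarrow> 1 \<le> m i"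
    and m_top: "m (Suc n) = 2"
begin

text \<open>Entries outside \<open>{1..k}\<close> are normalized to 0, so that each route has
  exactly one vector.\<close>

definition rvecs :: "(nat \<times> (nat \<Rightarrow> nat)) set" where
  "rvecs = {(k, r). 1 \<le> k \<and> k \<le> Suc n \<and> 0 < r k \<and> r k < m k \<and>
     (\<forall>i\<in>{1..<k}. r i = 0 \<or> r i = m i) \<and> (\<forall>i. i \<notin> {1..k} \<longrightarrow> r i = 0)}"

definition comparable :: "nat \<times> (nat \<Rightarrow> nat) \<Rightarrow> nat \<times> (nat \<Rightarrow> nat) \<Rightarrow> bool" where
  "comparable P Q \<longleftrightarrow> (\<forall>i\<in>{1..min (fst P) (fst Q)}. snd P i \<le> snd Q i) \<or>
     (\<forall>i\<in>{1..min (fst P) (fst Q)}. snd Q i \<le> snd P i)"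

definition clique :: "(nat \<times> (nat \<Rightarrow> nat)) set \<Rightarrow> bool" where
  "clique K \<longleftrightarrow> K \<subseteq> rvecs \<and> (\<forall>P\<in>K. \<forall>Q\<in>K. comparable P Q)"

definition full :: "(nat \<times> (nat \<Rightarrow> nat)) set \<Rightarrow> bool" where
  "full K \<longleftrightarrow> (\<forall>k t. 1 \<le> k \<and> k \<le> Suc n \<and> 0 < t \<and> t < m k \<longrightarrow> (\<exists>p. (k, p) \<in> K \<and> p k = t))"

definition interior_clique :: "(nat \<times> (nat \<Rightarrow> nat)) set \<Rightarrow> bool" where
  "interior_clique K \<longleftrightarrow> clique K \<and> full K \<and>
     (\<forall>a\<in>{1..n}. \<exists>k p. (k, p) \<in> K \<and> a < k \<and> p a = 0) \<and>
     (\<forall>a\<in>{1..n}. \<exists>k p. (k, p) \<in> K \<and> a < k \<and> p a = m a)"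

definition lo :: "(nat \<times> (nat \<Rightarrow> nat)) set \<Rightarrow> nat \<Rightarrow> nat \<Rightarrow> nat" where
  "lo K c a = Max ((\<lambda>P. snd P c) ` {P \<in> K. c \<le> fst P \<and> snd P a = 0})"

definition hi :: "(nat \<times> (nat \<Rightarrow> nat)) set \<Rightarrow> nat \<Rightarrow> nat \<Rightarrow> nat" where
  "hi K c a = Min ((\<lambda>P. snd P c) ` {P \<in> K. c \<le> fst P \<and> snd P a = m a})"

lemma m_pos': "1 \<le> i \<Longrightarrow> i \<le> Suc n \<Longrightarrow> 1 \<le> m i"
  using m_pos m_top by (cases "i = Suc n") auto

lemma rvecsD:
  assumes "(k, p) \<in> rvecs"
  shows "1 \<le> k" "k \<le> Suc n" "0 < p k" "p k < m k"
    "\<And>i. 1 \<le> i \<Longrightarrow> i < k \<Longrightarrow> p i = 0 \<or> p i = m i"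
    "\<And>i. 1 \<le> i \<Longrightarrow> i \<le> k \<Longrightarrow> p i \<le> m i"
      "\<And>i. k < i \<Longrightarrow> p i = 0" "p 0 = 0"
proof -
  have *: "\<forall>i\<in>{1..<k}. p i = 0 \<or> p i = m i" "0 < p k" "p k < m k"
    using assms by (simp_all add: rvecs_def)
  show "p i = 0 \<or> p i = m i" if "1 \<le> i" "i < k" for i using *(1) that by simp
  then show "p i \<le> m i" if "1 \<le> i" "i \<le> k" for i
    using that *(3) by (cases "i = k") force+
qed (use assms in \<open>simp_all add: rvecs_def\<close>)

lemma rvecs_eqI:
  assumes "(k, p) \<in> rvecs" "(k, q) \<in> rvecs"
    "\<And>i. 1 \<le> i \<Longrightarrow> i \<le> k \<Longrightarrow> p i = q i"
  shows "p = q"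
proof
  fix i show "p i = q i"
    using assms rvecsD(7)[OF assms(1), of i] rvecsD(7)[OF assms(2), of i]
      rvecsD(8)[OF assms(1)] rvecsD(8)[OF assms(2)]
    by (cases "i = 0"; cases "i \<le> k") auto
qed

lemma finite_rvecs: "finite rvecs"
proof -
  define B where "B = (\<Sum>i\<le>Suc n. m i)"
  define F where
    "F = {p. \<forall>i. (i \<in> {1..Suc n} \<longrightarrow> p i \<in> {..B}) \<and> (i \<notin> {1..Suc n} \<longrightarrow> p i = (0::nat))}"
  have "rvecs \<subseteq> {..Suc n} \<times> F"
  proof (rule subrelI)
    fix k p assume kp: "(k, p) \<in> rvecs"
    have "p i \<le> B" if "1 \<le> i" "i \<le> Suc n" for i
    proof (cases "i \<le> k")
      case True
      have "m i \<le> B" unfolding B_def using that by (intro member_le_sum) auto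
      then show ?thesis using rvecsD(6)[OF kp, of i] that True by simp
    qed (use rvecsD(7)[OF kp, of i] in auto)
    moreover have "p i = 0" if "\<not> (1 \<le> i \<and> i \<le> Suc n)" for i
      using rvecsD(2)[OF kp] rvecsD(7)[OF kp, of i] rvecsD(8)[OF kp] that by (cases "i = 0") auto
    ultimately show "(k, p) \<in> {..Suc n} \<times> F"
      using rvecsD(2)[OF kp] by (auto simp: F_def)
  qed
  moreover have "finite F"
    unfolding F_def by (rule finite_set_of_finite_funs) auto
  ultimately show ?thesis by (meson finite_SigmaI finite_atMost finite_subset)
qed

end

section \<open>The bounds \<open>lo\<close> and \<open>hi\<close> of an interior clique\<close>

locale interior = multiplicities +
  fixes K assumes K: "interior_clique K"
begin

lemma K_rvecs: "(k, p) \<in> K \<Longrightarrow> (k, p) \<in> rvecs"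
  using K by (auto simp: interior_clique_def clique_def)

lemmas KD = rvecsD[OF K_rvecs]

lemma finite_K: "finite K"
  by (rule finite_subset[OF _ finite_rvecs]) (use K in \<open>simp add: interior_clique_def clique_def\<close>)

text \<open>One strict entry fixes the direction in which two comparable routes compare; in this
  form the clique property is used throughout.\<close>

lemma le_if_less:
  assumes "(k, p) \<in> K" "(l, q) \<in> K" "p i < q i" "1 \<le> i" "i \<le> k" "i \<le> l"
    "1 \<le> j" "j \<le> k" "j \<le> l"
  shows "p j \<le> q j"
proof -
  have "comparable (k, p) (l, q)" using K assms(1,2) by (simp add: interior_clique_def clique_def)
  then show ?thesis
    unfolding comparable_def
  proof
    assume "\<forall>i\<in>{1..min (fst (k, p)) (fst (l, q))}. snd (l, q) i \<le> snd (k, p) i"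
    then have "q i \<le> p i" using assms by auto
    then show ?thesis using assms by simp
  qed (use assms in auto)
qed

lemma hit: "1 \<le> k \<Longrightarrow> k \<le> Suc n \<Longrightarrow> 0 < t \<Longrightarrow> t < m k \<Longrightarrow> \<exists>p. (k, p) \<in> K \<and> p k = t"
  using K by (simp add: interior_clique_def full_def)

lemma bump_used: "1 \<le> a \<Longrightarrow> a \<le> n \<Longrightarrow> \<exists>k p. (k, p) \<in> K \<and> a < k \<and> p a = 0"
  using K by (simp add: interior_clique_def)

lemma dip_used: "1 \<le> a \<Longrightarrow> a \<le> n \<Longrightarrow> \<exists>k p. (k, p) \<in> K \<and> a < k \<and> p a = m a"
  using K by (simp add: interior_clique_def)

lemma max_top:
  assumes "(k0, p0) \<in> K" "Q k0 p0"
  obtains k p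
    where "(k, p) \<in> K" "Q k p"
      "\<And>l q. (l, q) \<in> K \<Longrightarrow> Q l q \<Longrightarrow> l \<le> k"
proof -
  let ?A = "{P \<in> K. Q (fst P) (snd P)}"
  have fin: "finite (fst ` ?A)" "fst ` ?A \<noteq> {}" using finite_K assms by auto
  then obtain P where "P \<in> ?A" "fst P = Max (fst ` ?A)"
    by (metis (no_types, lifting) Max_in imageE)
  moreover have "l \<le> Max (fst ` ?A)" if "(l, q) \<in> K" "Q l q" for l q
    using that fin by (intro Max_ge) force+
  ultimately show thesis using that[of "fst P" "snd P"]
    by (metis (mono_tags, lifting) mem_Collect_eq prod.collapse)
qed

text \<open>A longest member with entry 0 at \<open>a\<close> must enter at \<open>Suc n\<close>: if
  it entered at \<open>k \<le> n\<close>, a member using the bump at \<open>k\<close> would lie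
  strictly below it there, hence also vanish at \<open>a\<close>, and be longer. This makes the
  maximum in \<open>lo\<close> range over a nonempty set.\<close>

lemma bottom_ex:
  assumes a: "1 \<le> a" "a \<le> n" shows "\<exists>p. (Suc n, p) \<in> K \<and> p a = 0"
proof -
  obtain k0 p0 where "(k0, p0) \<in> K" "a < k0 \<and> p0 a = 0"
    using bump_used[OF a] by blast
  then obtain k p where kp: "(k, p) \<in> K" "a < k \<and> p a = 0"
    and max: "\<And>l q. (l, q) \<in> K \<Longrightarrow> a < l \<and> q a = 0 \<Longrightarrow> l \<le> k"
    by (rule max_top[where Q = "\<lambda>k p. a < k \<and> p a = 0"]) blast
  have "k = Suc n"
  proof (rule ccontr)
    assume "k \<noteq> Suc n"
    then have k: "1 \<le> k" "k \<le> n" using KD(2)[OF kp(1)] kp(2) by auto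
    then obtain l q where lq: "(l, q) \<in> K" "k < l" "q k = 0"
      using bump_used[OF k] by blast
    then have "q a \<le> p a"
      using le_if_less[of l q k p k a] kp KD(3)[OF kp(1)] k a by auto
    then show False using max[OF lq(1)] lq(2) kp by auto
  qed
  then show ?thesis using kp by auto
qed

text \<open>The dual argument with dips; it makes the minimum in \<open>hi\<close> range over a
  nonempty set.\<close>

lemma top_ex:
  assumes a: "1 \<le> a" "a \<le> n" shows "\<exists>p. (Suc n, p) \<in> K \<and> p a = m a"
proof -
  obtain k0 p0 where "(k0, p0) \<in> K" "a < k0 \<and> p0 a = m a"
    using dip_used[OF a] by blast
  then obtain k p where kp: "(k, p) \<in> K" "a < k \<and> p a = m a"
    and max: "\<And>l q. (l, q) \<in> K \<Longrightarrow> a < l \<and> q a = m a \<Longrightarrow> l \<le> k"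
    by (rule max_top[where Q = "\<lambda>k p. a < k \<and> p a = m a"]) blast
  have "k = Suc n"
  proof (rule ccontr)
    assume "k \<noteq> Suc n"
    then have k: "1 \<le> k" "k \<le> n" using KD(2)[OF kp(1)] kp(2) by auto
    then obtain l q where lq: "(l, q) \<in> K" "k < l" "q k = m k"
      using dip_used[OF k] by blast
    then have "p a \<le> q a"
      using le_if_less[of k p l q k a] kp KD(4)[OF kp(1)] k a by auto
    moreover have "q a \<le> m a" using KD(6)[OF lq(1), of a] a lq kp by auto
    ultimately show False using max[OF lq(1)] lq(2) kp by auto
  qed
  then show ?thesis using kp by auto
qed

lemma lo_ge:
  assumes "(k, p) \<in> K" "c \<le> k" "p a = 0" shows "p c \<le> lo K c a"
  unfolding lo_def
proof (rule Max_ge)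
  show "p c \<in> (\<lambda>P. snd P c) ` {P \<in> K. c \<le> fst P \<and> snd P a = 0}"
    using assms by (intro image_eqI[of _ _ "(k, p)"]) auto
qed (use finite_K in simp)

lemma hi_le:
  assumes "(k, p) \<in> K" "c \<le> k" "p a = m a" shows "hi K c a \<le> p c"
  unfolding hi_def
proof (rule Min_le)
  show "p c \<in> (\<lambda>P. snd P c) ` {P \<in> K. c \<le> fst P \<and> snd P a = m a}"
    using assms by (intro image_eqI[of _ _ "(k, p)"]) auto
qed (use finite_K in simp)

lemma lo_ex:
  assumes "1 \<le> a" "a < c" "c \<le> Suc n"
  obtains k p where "(k, p) \<in> K" "c \<le> k" "p a = 0" "p c = lo K c a"
proof -
  let ?A = "{P \<in> K. c \<le> fst P \<and> snd P a = 0}"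
  obtain p where "(Suc n, p) \<in> K" "p a = 0" using bottom_ex[of a] assms by auto
  then have "(Suc n, p) \<in> ?A" using assms by simp
  then have "lo K c a \<in> (\<lambda>P. snd P c) ` ?A"
    unfolding lo_def using finite_K by (intro Max_in) auto
  then obtain P where "P \<in> ?A" "lo K c a = snd P c" by (rule imageE) auto
  then show thesis using that[of "fst P" "snd P"] by simp
qed

lemma hi_ex:
  assumes "1 \<le> a" "a < c" "c \<le> Suc n"
  obtains k p where "(k, p) \<in> K" "c \<le> k" "p a = m a" "p c = hi K c a"
proof -
  let ?A = "{P \<in> K. c \<le> fst P \<and> snd P a = m a}"
  obtain p where "(Suc n, p) \<in> K" "p a = m a" using top_ex[of a] assms by auto
  then have "(Suc n, p) \<in> ?A" using assms by simp
  then have "hi K c a \<in> (\<lambda>P. snd P c) ` ?A"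
    unfolding hi_def using finite_K by (intro Min_in) auto
  then obtain P where "P \<in> ?A" "hi K c a = snd P c" by (rule imageE) auto
  then show thesis using that[of "fst P" "snd P"] by simp
qed

lemma lo_le_hi:
  assumes "1 \<le> a" "a < c" "c \<le> n" shows "lo K c a \<le> hi K c a"
proof -
  obtain k p where p: "(k, p) \<in> K" "c \<le> k" "p a = 0" "p c = lo K c a"
    by (rule lo_ex[of a c]) (use assms in auto)
  obtain l q where q: "(l, q) \<in> K" "c \<le> l" "q a = m a" "q c = hi K c a"
    by (rule hi_ex[of a c]) (use assms in auto)
  show ?thesis using le_if_less[OF p(1) q(1), of a c] p q assms m_pos[of a] by auto
qed

lemma lo_le:
  assumes "1 \<le> a" "a < c" "c \<le> n" shows "lo K c a \<le> m c"
proof -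
  obtain k p where p: "(k, p) \<in> K" "c \<le> k" "p a = 0" "p c = lo K c a"
    by (rule lo_ex[of a c]) (use assms in auto)
  then show ?thesis using KD(6)[OF p(1), of c] assms by auto
qed

lemma hi_le_m:
  assumes "1 \<le> a" "a < c" "c \<le> n" shows "hi K c a \<le> m c"
proof -
  obtain k p where p: "(k, p) \<in> K" "c \<le> k" "p a = m a" "p c = hi K c a"
    by (rule hi_ex[of a c]) (use assms in auto)
  then show ?thesis using KD(6)[OF p(1), of c] assms by auto
qed

text \<open>Otherwise \<open>lo K c a + 1\<close> is a source edge at \<open>c\<close>. The member
  through it has entry 0 or \<open>m a\<close> at \<open>a\<close>, so its entry at \<open>c\<close>
  would be at most \<open>lo\<close> or at least \<open>hi\<close>.\<close>

lemma hi_le_lo: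
  assumes "1 \<le> a" "a < c" "c \<le> n" shows "hi K c a \<le> lo K c a + 1"
proof (rule ccontr)
  assume gt: "\<not> ?thesis"
  then obtain p where p: "(c, p) \<in> K" "p c = lo K c a + 1"
    using hit[of c "lo K c a + 1"] hi_le_m[of a c] assms by auto
  show False
    using KD(5)[OF p(1), of a] lo_ge[OF p(1), of c a] hi_le[OF p(1), of c a] p assms gt by auto
qed

text \<open>A route attaining \<open>lo K c b\<close> has entry 0 at \<open>b\<close>. If
  \<open>lo K b a > 0\<close>, it lies below the route attaining \<open>lo K b a\<close>, so it
  vanishes at \<open>a\<close> too and competes in the maximum for \<open>lo K c a\<close>.\<close>

lemma lo_trans:
  assumes "1 \<le> a" "a < b" "b < c" "c \<le> n" shows "lo K b a = 0 \<or> lo K c b \<le> lo K c a"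
proof (intro disjCI)
  assume nz: "\<not> lo K c b \<le> lo K c a"
  obtain k p where p: "(k, p) \<in> K" "b \<le> k" "p a = 0" "p b = lo K b a"
    by (rule lo_ex[of a b]) (use assms in auto)
  obtain l q where q: "(l, q) \<in> K" "c \<le> l" "q b = 0" "q c = lo K c b"
    by (rule lo_ex[of b c]) (use assms in auto)
  show "lo K b a = 0"
  proof (rule ccontr)
    assume "lo K b a \<noteq> 0"
    then have "q a = 0" using le_if_less[OF q(1) p(1), of b a] p q assms by auto
    then show False using lo_ge[OF q(1), of c a] q nz by auto
  qed
qed

text \<open>The route attaining \<open>lo K c a\<close> passes \<open>b\<close> by the bump or by
  the dip: the bump makes it a candidate for \<open>lo K c b\<close>, the dip lifts
  \<open>lo K b a\<close> to \<open>m b\<close>.\<close>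

lemma lo_planar:
  assumes "1 \<le> a" "a < b" "b < c" "c \<le> n"
    shows "lo K b a = m b \<or> lo K c a \<le> lo K c b"
proof -
  obtain l q where q: "(l, q) \<in> K" "c \<le> l" "q a = 0" "q c = lo K c a"
    by (rule lo_ex[of a c]) (use assms in auto)
  have "q b = 0 \<or> q b = m b" using KD(5)[OF q(1), of b] assms q by auto
  then show ?thesis
    using lo_ge[OF q(1), of c b] lo_ge[OF q(1), of b a] lo_le[of a b] q assms by auto
qed

text \<open>For \<open>hi\<close> the two arguments change places: transitivity follows from a
  single route passing \<open>b\<close> by bump or dip, planarity from comparing two routes.\<close>

lemma hi_trans:
  assumes "1 \<le> a" "a < b" "b < c" "c \<le> n" shows "hi K b a = 0 \<or> hi K c b \<le> hi K c a"
proof -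
  obtain l q where q: "(l, q) \<in> K" "c \<le> l" "q a = m a" "q c = hi K c a"
    by (rule hi_ex[of a c]) (use assms in auto)
  have "q b = 0 \<or> q b = m b" using KD(5)[OF q(1), of b] assms q by auto
  then show ?thesis
    using hi_le[OF q(1), of c b] hi_le[OF q(1), of b a] q assms by auto
qed

lemma hi_planar:
  assumes "1 \<le> a" "a < b" "b < c" "c \<le> n"
    shows "hi K b a = m b \<or> hi K c a \<le> hi K c b"
proof (intro disjCI)
  assume nz: "\<not> hi K c a \<le> hi K c b"
  obtain k p where p: "(k, p) \<in> K" "b \<le> k" "p a = m a" "p b = hi K b a"
    by (rule hi_ex[of a b]) (use assms in auto)
  obtain l q where q: "(l, q) \<in> K" "c \<le> l" "q b = m b" "q c = hi K c b"
    by (rule hi_ex[of b c]) (use assms in auto)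
  show "hi K b a = m b"
  proof (rule ccontr)
    assume "hi K b a \<noteq> m b"
    then have "hi K b a < m b" using hi_le_m[of a b] assms by auto
    then have "m a \<le> q a" using le_if_less[OF p(1) q(1), of b a] p q assms by auto
    then have "q a = m a" using KD(6)[OF q(1), of a] q assms by auto
    then show False using hi_le[OF q(1), of c a] q nz by auto
  qed
qed

text \<open>
  The two bounds determine the clique: for a vector \<open>r\<close> respecting them, the members of \<open>K\<close>
  through the edge \<open>(k, r k)\<close> form a chain, and for each pair of letters \<open>a\<close>, \<open>b\<close> some member of
  this chain agrees with \<open>r\<close> at both; hence one member agrees with \<open>r\<close> everywhere.
\<close>

lemma mem_if_between:
  assumes r: "(k, r) \<in> rvecs"
    and lo: "\<And>a c. 1 \<le> a \<Longrightarrow> a < c \<Longrightarrow> c \<le> k \<Longrightarrow> r a = 0 \<Longrightarrow> r c \<le> lo K c a"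
    and hi: "\<And>a c. 1 \<le> a \<Longrightarrow> a < c \<Longrightarrow> c \<le> k \<Longrightarrow> r a = m a \<Longrightarrow> hi K c a \<le> r c"
  shows "(k, r) \<in> K"
proof -
  note rD = rvecsD[OF r]
  \<comment> \<open>A route longer than \<open>k\<close> has entry 0 or full at \<open>k\<close>,
    whereas \<open>r k\<close> lies strictly between; hence having this entry means entering through
    this edge.\<close>
  have top: "l = k" if "(l, q) \<in> K" "k \<le> l" "q k = r k" for l q
    using KD(5)[OF that(1), of k] that rD(1,3,4) by (cases "l = k") auto
  obtain p0 where p0: "(k, p0) \<in> K" "p0 k = r k" using hit rD by blast
  \<comment> \<open>The route attaining \<open>lo K k a\<close> has entry at least
    \<open>r k\<close> at \<open>k\<close>. With equality it enters through the right edge;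
    otherwise it dominates \<open>p0\<close>, which then vanishes at \<open>a\<close> as
    well.\<close>
  have step1: "\<exists>p. (k, p) \<in> K \<and> p k = r k \<and> p a = 0"
    if a: "1 \<le> a" "a < k" "r a = 0" for a
  proof -
    obtain l q where q: "(l, q) \<in> K" "k \<le> l" "q a = 0" "q k = lo K k a"
      by (rule lo_ex[of a k]) (use a rD in auto)
    have "r k \<le> q k" using lo[of a k] a q by auto
    then consider "q k = r k" | "r k < q k" by linarith
    then show ?thesis
    proof cases
      case 1 then show ?thesis using top q by blast
    next
      case 2
      then have "p0 a \<le> q a" using le_if_less[OF p0(1) q(1), of k a] p0 q a by auto
      then show ?thesis using p0 q by auto
    qed
  qed
  have step2: "\<exists>p. (k, p) \<in> K \<and> p k = r k \<and> p a = m a"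
    if a: "1 \<le> a" "a < k" "r a = m a" for a
  proof -
    obtain l q where q: "(l, q) \<in> K" "k \<le> l" "q a = m a" "q k = hi K k a"
      by (rule hi_ex[of a k]) (use a rD in auto)
    have "q k \<le> r k" using hi[of a k] a q by auto
    then consider "q k = r k" | "q k < r k" by linarith
    then show ?thesis
    proof cases
      case 1 then show ?thesis using top q by blast
    next
      case 2
      then have "q a \<le> p0 a" using le_if_less[OF q(1) p0(1), of k a] p0 q a by auto
      then show ?thesis using p0 q KD(6)[OF p0(1), of a] a by (intro exI[of _ p0]) auto
    qed
  qed
  have step3: "\<exists>p. (k, p) \<in> K \<and> p k = r k \<and> p a = 0 \<and> p b = m b"
    if a: "1 \<le> a" "a < k" "r a = 0" and b: "1 \<le> b" "b < k" "r b = m b" for a b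
  proof -
    have "a \<noteq> b" using a b m_pos'[of a] rD(2) by auto
    have "\<exists>l q. (l, q) \<in> K \<and> (a < l \<and> b < l \<and> q a = 0 \<and> q b = m b)"
    proof (cases "a < b")
      case True
      obtain l q where q: "(l, q) \<in> K" "b \<le> l" "q a = 0" "q b = lo K b a"
        by (rule lo_ex[of a b]) (use a b True rD in auto)
      have "m b \<le> q b" using lo[of a b] a b True q by auto
      then have "q b = m b" "b \<noteq> l" using KD(4)[OF q(1)] KD(6)[OF q(1), of b] b q by auto
      then show ?thesis using q True by (metis le_neq_implies_less less_trans)
    next
      case False
      then have ba: "b < a" using \<open>a \<noteq> b\<close> by auto
      obtain l q where q: "(l, q) \<in> K" "a \<le> l" "q b = m b" "q a = hi K a b"
        by (rule hi_ex[of b a]) (use a b ba rD in auto)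
      have "q a = 0" using hi[of b a] a b ba q by auto
      then have "a \<noteq> l" using KD(3)[OF q(1)] by auto
      then show ?thesis using q ba \<open>q a = 0\<close> by (metis le_neq_implies_less less_trans)
    qed
    then obtain l0 q0
      where "(l0, q0) \<in> K" "a < l0 \<and> b < l0 \<and> q0 a = 0 \<and> q0 b = m b" by blast
    then obtain l q where q: "(l, q) \<in> K" "a < l \<and> b < l \<and> q a = 0 \<and> q b = m b"
      and max: "\<And>l' q'. (l', q') \<in> K \<Longrightarrow> a < l' \<and> b < l' \<and> q' a = 0 \<and> q' b = m b \<Longrightarrow> l' \<le> l"
      by (rule max_top[where Q = "\<lambda>l q. a < l \<and> b < l \<and> q a = 0 \<and> q b = m b"]) blast
    \<comment> \<open>If this longest member entered at \<open>l < k\<close>, where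
      \<open>r l\<close> is 0 or full, the bound on \<open>r\<close> at \<open>l\<close> coming from
      \<open>b\<close> (respectively \<open>a\<close>) would supply a member passing
      \<open>l\<close> on the same side as \<open>r\<close>. Comparing it with \<open>q\<close> at
      \<open>l\<close> transfers the entry at the other letter, so it is a longer member with the
      same two entries.\<close>
    have "k \<le> l"
    proof (rule ccontr)
      assume "\<not> k \<le> l"
      then have l: "1 \<le> l" "l < k" using KD(1)[OF q(1)] by auto
      consider "r l = 0" | "r l = m l" using rD(5)[of l] l by auto
      then have "\<exists>l' q'. (l', q') \<in> K \<and> l < l' \<and> q' a = 0 \<and> q' b = m b"
      proof cases
        case 1
        obtain l' q' where q': "(l', q') \<in> K" "l \<le> l'" "q' b = m b" "q' l = hi K l b"
          by (rule hi_ex[of b l]) (use q b l rD in auto)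
        have z: "q' l = 0" using hi[of b l] b l q q' 1 by auto
        then have "q' a \<le> q a" using le_if_less[OF q'(1) q(1), of l a] KD(3)[OF q(1)] l q q' a
          by auto
        moreover have "l \<noteq> l'" using z KD(3)[OF q'(1)] by auto
        ultimately show ?thesis using q q' by (intro exI[of _ l'] exI[of _ q']) auto
      next
        case 2
        obtain l' q' where q': "(l', q') \<in> K" "l \<le> l'" "q' a = 0" "q' l = lo K l a"
          by (rule lo_ex[of a l]) (use q a l rD in auto)
        have z: "m l \<le> q' l" using lo[of a l] a l q q' 2 by auto
        then have "q b \<le> q' b" using le_if_less[OF q(1) q'(1), of l b] KD(4)[OF q(1)] l q q' b
          by auto
        moreover have "l \<noteq> l'" using z KD(4)[OF q'(1)] by auto
        moreover have "q' b \<le> m b" using KD(6)[OF q'(1), of b] b q q' by auto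
        ultimately show ?thesis using q q' by (intro exI[of _ l'] exI[of _ q']) auto
      qed
      then obtain l' q' where "(l', q') \<in> K" "l < l'" "q' a = 0" "q' b = m b" by blast
      with max[of l' q'] q show False by auto
    qed
    consider "q k = r k" | "q k < r k" | "r k < q k" by linarith
    then show ?thesis
    proof cases
      case 1 then show ?thesis using top q \<open>k \<le> l\<close> by blast
    next
      case 2
      obtain p where p: "(k, p) \<in> K" "p k = r k" "p a = 0" using step1 a by blast
      then have "q b \<le> p b" using le_if_less[OF q(1) p(1), of k b] 2 b \<open>k \<le> l\<close>
        by auto
      moreover have "p b \<le> m b" using KD(6)[OF p(1), of b] b by auto
      ultimately show ?thesis using p q by (intro exI[of _ p]) auto
    next
      case 3
      obtain p where p: "(k, p) \<in> K" "p k = r k" "p b = m b" using step2 b by blast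
      then have "p a \<le> q a" using le_if_less[OF p(1) q(1), of k a] 3 a \<open>k \<le> l\<close>
        by auto
      then show ?thesis using p q by (intro exI[of _ p]) auto
    qed
  qed
  have chain: "(\<forall>i\<in>{1..k}. p i \<le> q i) \<or> (\<forall>i\<in>{1..k}. q i \<le> p i)"
    if "(k, p) \<in> K" "(k, q) \<in> K" for p q
  proof -
    have "comparable (k, p) (k, q)" using K that by (auto simp: interior_clique_def clique_def)
    then show ?thesis by (simp add: comparable_def)
  qed
  \<comment> \<open>Of two witnesses in the chain, the larger one has the full entries of both, and
    both vanish on \<open>Z\<close>; so witnesses for single letters merge into one.\<close>
  have raise: "\<exists>p. (k, p) \<in> K \<and> p k = r k \<and> (\<forall>a\<in>Z. p a = 0) \<and> (\<forall>b\<in>B. p b = m b)"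
    if "finite B" "Z \<subseteq> {1..<k}" "B \<subseteq> {b\<in>{1..<k}. r b = m b}"
      and start: "\<exists>p. (k, p) \<in> K \<and> p k = r k \<and> (\<forall>a\<in>Z. p a = 0)"
      and one: "\<And>b. b \<in> B \<Longrightarrow> \<exists>p. (k, p) \<in> K \<and> p k = r k \<and> (\<forall>a\<in>Z. p a = 0) \<and> p b = m b" for Z B
    using that(1,3) one
  proof (induction B rule: finite_induct)
    case empty
    then show ?case using start by auto
  next
    case (insert b B)
    then obtain p
      where p: "(k, p) \<in> K" "p k = r k" "\<forall>a\<in>Z. p a = 0"
        "\<forall>b\<in>B. p b = m b" by auto
    obtain q where q: "(k, q) \<in> K" "q k = r k" "\<forall>a\<in>Z. q a = 0" "q b = m b"
      using insert.prems(2)[of b] by auto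
    have in_k: "i \<in> {1..k}" if "i \<in> insert b B" for i using that insert.prems(1) by auto
    from chain[OF p(1) q(1)] show ?case
    proof
      assume le: "\<forall>i\<in>{1..k}. p i \<le> q i"
      have "q i = m i" if "i \<in> insert b B" for i
        using le in_k[OF that] p(4) q(4) KD(6)[OF q(1), of i] that
          by (metis antisym atLeastAtMost_iff insertE)
      then show ?thesis using q by blast
    next
      assume le: "\<forall>i\<in>{1..k}. q i \<le> p i"
      have "p i = m i" if "i \<in> insert b B" for i
        using le in_k[OF that] p(4) q(4) KD(6)[OF p(1), of i] that
          by (metis antisym atLeastAtMost_iff insertE)
      then show ?thesis using p by blast
    qed
  qed
  define B where "B = {b\<in>{1..<k}. r b = m b}"
  \<comment> \<open>Dually, the smaller of two witnesses has the zeros of both, while both are full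
    on \<open>B\<close>.\<close>
  have lower: "\<exists>p. (k, p) \<in> K \<and> p k = r k \<and> (\<forall>a\<in>Z. p a = 0) \<and> (\<forall>b\<in>B. p b = m b)"
    if "finite Z" "Z \<subseteq> {a\<in>{1..<k}. r a = 0}" for Z
    using that
  proof (induction Z rule: finite_induct)
    case empty
    show ?case using p0 step2 by (intro raise) (auto simp: B_def)
  next
    case (insert a Z)
    then obtain p
      where p: "(k, p) \<in> K" "p k = r k" "\<forall>a\<in>Z. p a = 0"
        "\<forall>b\<in>B. p b = m b" by auto
    have "\<exists>q. (k, q) \<in> K \<and> q k = r k \<and> (\<forall>a'\<in>{a}. q a' = 0) \<and> (\<forall>b\<in>B. q b = m b)"
      using step1[of a] step3[of a] insert.prems by (intro raise) (auto simp: B_def)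
    then obtain q where q: "(k, q) \<in> K" "q k = r k" "q a = 0" "\<forall>b\<in>B. q b = m b"
      by auto
    have in_k: "i \<in> {1..k}" if "i \<in> insert a Z" for i using that insert.prems(1) by auto
    from chain[OF p(1) q(1)] show ?case
    proof
      assume le: "\<forall>i\<in>{1..k}. p i \<le> q i"
      have "p i = 0" if "i \<in> insert a Z" for i
        using le in_k[OF that] p(3) q(3) that by (metis insertE le_zero_eq)
      then show ?thesis using p by blast
    next
      assume le: "\<forall>i\<in>{1..k}. q i \<le> p i"
      have "q i = 0" if "i \<in> insert a Z" for i
        using le in_k[OF that] p(3) q(3) that by (metis insertE le_zero_eq)
      then show ?thesis using q by blast
    qed
  qed
  obtain p where p: "(k, p) \<in> K" "p k = r k" "\<forall>a\<in>{a\<in>{1..<k}. r a = 0}. p a = 0"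
    "\<forall>b\<in>B. p b = m b"
    using lower[of "{a\<in>{1..<k}. r a = 0}"] by auto
  have "p = r"
  proof (rule rvecs_eqI[OF K_rvecs[OF p(1)] r])
    fix i assume "1 \<le> i" "i \<le> k"
    then show "p i = r i" using p rD(5)[of i] by (cases "i = k") (auto simp: B_def)
  qed
  then show ?thesis using p by simp
qed

end

section \<open>Faces as cliques of prefixes\<close>

text \<open>Two prefixes of one word are nested. A shorter \<open>u'\<close> would miss the last
  letter of \<open>u\<close>, and a longer one would contain an extra copy of the letter following
  \<open>u\<close>.\<close>

lemma prefix_eqI:
  assumes "u @ v = u' @ v'" "u \<noteq> []" "v \<noteq> []"
    and "count_list u (last u) \<le> count_list u' (last u)"
    and "count_list u' (hd v) \<le> count_list u (hd v)"
  shows "u' = u"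
proof -
  from assms(1) consider y where "u' = u @ y" "v = y @ v'" | y where "u = u' @ y" "v' = y @ v"
    by (auto simp: append_eq_append_conv2)
  then show ?thesis
  proof cases
    case 1
    then show ?thesis using assms(5) by (cases y) auto
  next
    case 2
    then show ?thesis using assms(4) by (cases y rule: rev_cases) auto
  qed
qed

lemma ascents_appendI:
  assumes "u \<noteq> []" "v \<noteq> []" "last u < hd v"
  shows "(last u, hd v) \<in> ascents (u @ v)"
proof -
  obtain u' a where u: "u = u' @ [a]" using assms(1) by (cases u rule: rev_cases) auto
  obtain c v' where v: "v = c # v'" using assms(2) by (cases v) auto
  have "sublist [a, c] (u' @ [a, c] @ v')" by (rule sublist_appendI)
  then show ?thesis using assms(3) u v by (simp add: ascents_def)
qed

lemma ascentsE:
  assumes "(a, c) \<in> ascents w"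
  obtains u v where "w = u @ v" "u \<noteq> []" "v \<noteq> []" "last u = a" "hd v = c" "a < c"
proof -
  from assms obtain x y where "w = x @ [a, c] @ y" "a < c"
    by (auto simp: ascents_def sublist_def)
  then show thesis using that[of "x @ [a]" "c # y"] by simp
qed

text \<open>A copy of \<open>last u\<close> to the right of \<open>hd v\<close> would complete a
  forbidden pattern.\<close>

lemma count_ascent_bottom:
  assumes w: "stirling_on S m (u @ v)"
    and "u \<noteq> []" "v \<noteq> []" "last u < hd v" "last u \<in> S"
  shows "count_list u (last u) = m (last u)"
proof -
  obtain u' a where u: "u = u' @ [a]" using assms(2) by (cases u rule: rev_cases) auto
  obtain c v' where v: "v = c # v'" using assms(3) by (cases v) auto
  have "stirling_on S m (u @ [c] @ v')" using w v by simp
  then have "a \<notin> set v'"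
    using no_larger_between[of S m u "[c]" v' a c] assms(4) u v by auto
  moreover have "a \<in> S" using assms(5) u by simp
  then have "count_list (u @ v) a = m a" using w unfolding stirling_on_def by blast
  ultimately show ?thesis using u v assms(4) by simp
qed

section \<open>Routes that agree with prefixes of a Stirling word\<close>

context multiplicities
begin

abbreviation stirling :: "nat list \<Rightarrow> bool" where
  "stirling \<equiv> stirling_on {1..n} m"

text \<open>The index \<open>Suc n\<close> is excluded because no letter belongs to it; a route
  entering there always has entry 1.\<close>

definition agrees :: "nat \<times> (nat \<Rightarrow> nat) \<Rightarrow> nat list \<Rightarrow> bool" where
  "agrees P u \<longleftrightarrow> (\<forall>i. 1 \<le> i \<and> i \<le> fst P \<and> i \<le> n \<longrightarrow> snd P i = count_list u i)"

lemma agreesD: "agrees (k, p) u \<Longrightarrow> 1 \<le> i \<Longrightarrow> i \<le> k \<Longrightarrow> i \<le> n \<Longrightarrow> p i = count_list u i"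
  by (simp add: agrees_def)

lemma stirling_count: "stirling w \<Longrightarrow> 1 \<le> i \<Longrightarrow> i \<le> n \<Longrightarrow> count_list w i = m i"
  by (simp add: stirling_on_def)

lemma stirling_set: "stirling w \<Longrightarrow> i \<in> set w \<Longrightarrow> 1 \<le> i \<and> i \<le> n"
  by (auto simp: stirling_on_def)

text \<open>The route enters at the smallest letter that is begun but not exhausted in
  \<open>u\<close>, or at \<open>Suc n\<close> if there is none; all smaller letters are untouched
  or used up. A letter \<open>k\<close> of this kind occurs on both sides of the cut, so neither
  letter next to the cut can exceed it.\<close>

lemma prefix_rvec:
  assumes w: "stirling (u @ v)"
  obtains k p where "(k, p) \<in> rvecs" "agrees (k, p) u"
    "u \<noteq> [] \<Longrightarrow> last u \<le> k" "v \<noteq> [] \<Longrightarrow> hd v \<le> k"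
    "\<And>i. 1 \<le> i \<Longrightarrow> i \<le> n \<Longrightarrow> 0 < count_list u i \<Longrightarrow> count_list u i < m i \<Longrightarrow> k \<le> i"
proof -
  define partial
    where "partial i \<longleftrightarrow> 1 \<le> i \<and> (i = Suc n \<or> i \<le> n \<and> 0 < count_list u i \<and> count_list u i < m i)" for i
  define k where "k = (LEAST i. partial i)"
  have "partial (Suc n)" by (simp add: partial_def)
  then have k: "partial k" unfolding k_def by (rule LeastI)
  have least: "k \<le> i" if "partial i" for i unfolding k_def using that by (rule Least_le)
  have k1: "1 \<le> k" "k \<le> Suc n" using k by (auto simp: partial_def)
  define p where "p i = (if i = Suc n \<and> k = Suc n then 1 else if 1 \<le> i \<and> i \<le> k then count_list u i else 0)" for i
  have cm: "count_list u i \<le> m i" if "1 \<le> i" "i \<le> n" for i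
    using count_prefix_le[OF w] that by simp
  have "count_list u i = 0 \<or> count_list u i = m i" if "1 \<le> i" "i < k" for i
    using least[of i] that k1 cm[of i] unfolding partial_def by linarith
  then have 1: "(k, p) \<in> rvecs"
    using k k1 m_top by (auto simp: rvecs_def p_def partial_def)
  have 2: "agrees (k, p) u" by (simp add: agrees_def p_def)
  have 3: "last u \<le> k" if ne: "u \<noteq> []"
  proof (rule ccontr)
    assume c: "\<not> last u \<le> k"
    obtain u' a where u: "u = u' @ [a]" using ne by (cases u rule: rev_cases) auto
    have "a \<le> n" using stirling_set[OF w, of a] u by auto
    then have kn: "k \<le> n" "k < a" using c u by auto
    have kk: "0 < count_list u k" "count_list u k < m k" using k kn by (auto simp: partial_def)
    have "k \<in> set u'" using kk(1) u kn(2) count_notin[of k u'] by (cases "k \<in> set u'") auto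
    moreover have "k \<in> set v"
      using stirling_count[OF w, of k] kk(2) kn k1 count_notin[of k v]
        by (cases "k \<in> set v") auto
    ultimately show False using no_larger_between[of "{1..n}" m u' "[a]" v k a] w u kn by auto
  qed
  have 4: "hd v \<le> k" if ne: "v \<noteq> []"
  proof (rule ccontr)
    assume c: "\<not> hd v \<le> k"
    obtain a v' where v: "v = a # v'" using ne by (cases v) auto
    have "a \<le> n" using stirling_set[OF w, of a] v by auto
    then have kn: "k \<le> n" "k < a" using c v by auto
    have kk: "0 < count_list u k" "count_list u k < m k" using k kn by (auto simp: partial_def)
    have "k \<in> set u" using kk(1) count_notin[of k u] by (cases "k \<in> set u") auto
    moreover have "k \<in> set v'"
      using stirling_count[OF w, of k] kk(2) kn k1 v count_notin[of k v']
        by (cases "k \<in> set v'") auto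
    ultimately show False using no_larger_between[of "{1..n}" m u "[a]" v' k a] w v kn by auto
  qed
  have 5: "k \<le> i" if "1 \<le> i" "i \<le> n" "0 < count_list u i" "count_list u i < m i" for i
    using least[of i] that by (simp add: partial_def)
  show thesis by (rule that[OF 1 2 3 4 5])
qed

lemma block_end:
  assumes w: "stirling w" and a: "1 \<le> a" "a \<le> n"
  obtains u v where "w = u @ v" "u \<noteq> []" "last u = a" "count_list u a = m a"
proof -
  have "a \<in> set w"
    using stirling_count[OF w a] m_pos[OF a] count_notin[of a w] by (cases "a \<in> set w") auto
  then obtain x y where "w = x @ a # y" "a \<notin> set y" by (meson split_list_last)
  then show thesis using that[of "x @ [a]" y] stirling_count[OF w a] by simp
qed

text \<open>Since a route may agree with several prefixes, it is kept as soon as one of them is not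
  cut at an ascent of \<open>A\<close>.\<close>

definition face_clique :: "nat list \<Rightarrow> (nat \<times> nat) set \<Rightarrow> (nat \<times> (nat \<Rightarrow> nat)) set" where
  "face_clique w A = {P \<in> rvecs. \<exists>u v. w = u @ v \<and> agrees P u \<and>
     \<not> (u \<noteq> [] \<and> v \<noteq> [] \<and> (last u, hd v) \<in> A)}"

lemma face_clique_ex:
  assumes w: "stirling (u @ v)"
    and "\<not> (u \<noteq> [] \<and> v \<noteq> [] \<and> (last u, hd v) \<in> A)"
  obtains k p where "(k, p) \<in> face_clique (u @ v) A" "agrees (k, p) u"
    "u \<noteq> [] \<Longrightarrow> last u \<le> k" "v \<noteq> [] \<Longrightarrow> hd v \<le> k"
    "\<And>i. 1 \<le> i \<Longrightarrow> i \<le> n \<Longrightarrow> 0 < count_list u i \<Longrightarrow> count_list u i < m i \<Longrightarrow> k \<le> i"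
proof -
  obtain k p where kp: "(k, p) \<in> rvecs" "agrees (k, p) u"
    "u \<noteq> [] \<Longrightarrow> last u \<le> k" "v \<noteq> [] \<Longrightarrow> hd v \<le> k"
    "\<And>i. 1 \<le> i \<Longrightarrow> i \<le> n \<Longrightarrow> 0 < count_list u i \<Longrightarrow> count_list u i < m i \<Longrightarrow> k \<le> i"
    using prefix_rvec[OF w] by metis
  then have "(k, p) \<in> face_clique (u @ v) A" using assms(2) by (auto simp: face_clique_def)
  then show thesis using that kp by blast
qed

lemma face_cliqueE:
  assumes "(k, p) \<in> face_clique w A"
  obtains u v
    where "w = u @ v" "agrees (k, p) u"
      "\<not> (u \<noteq> [] \<and> v \<noteq> [] \<and> (last u, hd v) \<in> A)"
    "(k, p) \<in> rvecs"
  using assms unfolding face_clique_def by blast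

text \<open>Comparability holds because prefixes of one word are nested. The empty prefix and the
  whole word supply all bumps and all dips. The source edge \<open>t\<close> at a letter
  \<open>c\<close> is met by the prefix ending in the \<open>t\<close>-th copy of \<open>c\<close>:
  as \<open>c\<close> is not exhausted there, the cut is not an ascent.\<close>

lemma interior_face_clique:
  assumes w: "stirling w" and A: "A \<subseteq> ascents w"
  shows "interior_clique (face_clique w A)"
  unfolding interior_clique_def
proof (intro conjI)
  show "clique (face_clique w A)"
    unfolding clique_def
  proof (intro conjI ballI)
    show "face_clique w A \<subseteq> rvecs" by (auto simp: face_clique_def)
    fix P Q assume PQ: "P \<in> face_clique w A" "Q \<in> face_clique w A"
    obtain k p l q where pq: "P = (k, p)" "Q = (l, q)" by (cases P, cases Q)
    obtain u v where u: "w = u @ v" "agrees (k, p) u" "(k, p) \<in> rvecs"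
      using PQ(1) unfolding pq by (rule face_cliqueE)
    obtain u' v' where u': "w = u' @ v'" "agrees (l, q) u'" "(l, q) \<in> rvecs"
      using PQ(2) unfolding pq by (rule face_cliqueE)
    have top: "p (Suc n) = q (Suc n)" if "Suc n \<le> k" "Suc n \<le> l"
      using that rvecsD(2,3,4)[OF u(3)] rvecsD(2,3,4)[OF u'(3)] m_top by auto
    have eq: "i = Suc n \<or> i \<le> n" if "i \<le> k" for i using rvecsD(2)[OF u(3)] that by auto
    have "u @ v = u' @ v'" using u u' by simp
    then consider y where "u' = u @ y" | y where "u = u' @ y"
      by (auto simp: append_eq_append_conv2)
    then show "comparable P Q"
    proof cases
      case 1
      have "p i \<le> q i" if "1 \<le> i" "i \<le> k" "i \<le> l" for i
        using eq[OF that(2)] agreesD[OF u(2) that(1,2)] agreesD[OF u'(2) that(1,3)] top that 1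
          by auto
      then show ?thesis by (auto simp: comparable_def pq)
    next
      case 2
      have "q i \<le> p i" if "1 \<le> i" "i \<le> k" "i \<le> l" for i
        using eq[OF that(2)] agreesD[OF u(2) that(1,2)] agreesD[OF u'(2) that(1,3)] top that 2
          by auto
      then show ?thesis by (auto simp: comparable_def pq)
    qed
  qed
  obtain k0 p0 where 0: "(k0, p0) \<in> face_clique w A" "agrees (k0, p0) []"
    "w \<noteq> [] \<Longrightarrow> hd w \<le> k0"
      "\<And>i. 1 \<le> i \<Longrightarrow> i \<le> n \<Longrightarrow> 0 < count_list [] i \<Longrightarrow> count_list [] i < m i \<Longrightarrow> k0 \<le> i"
    using face_clique_ex[of "[]" w A] w by (metis append_Nil)
  have r0: "(k0, p0) \<in> rvecs" using 0(1) by (rule face_cliqueE)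
  have k0: "k0 = Suc n"
  proof (rule ccontr)
    assume "k0 \<noteq> Suc n"
    then have "1 \<le> k0" "k0 \<le> n" "0 < p0 k0" using rvecsD(1,2,3)[OF r0] by auto
    then show False using agreesD[OF 0(2), of k0] by simp
  qed
  obtain k1 p1 where 1: "(k1, p1) \<in> face_clique w A" "agrees (k1, p1) w"
    using face_clique_ex[of w "[]" A] w by (metis append_Nil2)
  have r1: "(k1, p1) \<in> rvecs" using 1(1) by (rule face_cliqueE)
  have k1: "k1 = Suc n"
  proof (rule ccontr)
    assume "k1 \<noteq> Suc n"
    then have "1 \<le> k1" "k1 \<le> n" "p1 k1 < m k1" using rvecsD(1,2,4)[OF r1] by auto
    then show False using agreesD[OF 1(2), of k1] stirling_count[OF w, of k1] by simp
  qed
  show "\<forall>a\<in>{1..n}. \<exists>k p. (k, p) \<in> face_clique w A \<and> a < k \<and> p a = 0"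
  proof
    fix a assume "a \<in> {1..n}"
    then have "p0 a = 0" using agreesD[OF 0(2), of a] k0 by simp
    then show "\<exists>k p. (k, p) \<in> face_clique w A \<and> a < k \<and> p a = 0"
      using 0(1) k0 \<open>a \<in> {1..n}\<close> by (intro exI[of _ k0] exI[of _ p0]) simp
  qed
  show "\<forall>a\<in>{1..n}. \<exists>k p. (k, p) \<in> face_clique w A \<and> a < k \<and> p a = m a"
  proof
    fix a assume "a \<in> {1..n}"
    then have "p1 a = m a" using agreesD[OF 1(2), of a] k1 stirling_count[OF w, of a] by simp
    then show "\<exists>k p. (k, p) \<in> face_clique w A \<and> a < k \<and> p a = m a"
      using 1(1) k1 \<open>a \<in> {1..n}\<close> by (intro exI[of _ k1] exI[of _ p1]) simp
  qed
  show "full (face_clique w A)"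
    unfolding full_def
  proof (intro allI impI, elim conjE)
    fix c t assume c: "1 \<le> c" "c \<le> Suc n" "0 < t" "t < m c"
    show "\<exists>p. (c, p) \<in> face_clique w A \<and> p c = t"
    proof (cases "c = Suc n")
      case True
      then have "p0 c = t"
        using k0 rvecsD(3,4)[OF r0] c m_top by auto
      then show ?thesis using 0(1) k0 True by blast
    next
      case False
      then have cn: "c \<le> n" using c by simp
      have split: "\<exists>u v. w = u @ v \<and> u \<noteq> [] \<and> last u = c \<and> count_list u c = t" if "0 < t" "t \<le> count_list w c" for t and w :: "nat list"
        using that
      proof (induction w rule: rev_induct)
        case (snoc x w)
        show ?case
        proof (cases "t \<le> count_list w c")
          case True
          then obtain u v where "w = u @ v" "u \<noteq> []" "last u = c" "count_list u c = t"
            using snoc by blast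
          then show ?thesis by (intro exI[of _ u] exI[of _ "v @ [x]"]) simp
        next
          case False
          then have "x = c" "t = count_list (w @ [x]) c" using snoc.prems by (auto split: if_splits)
          then show ?thesis by (intro exI[of _ "w @ [x]"] exI[of _ "[]"]) simp
        qed
      qed simp
      obtain u v where u: "w = u @ v" "u \<noteq> []" "last u = c" "count_list u c = t"
        using split[of t w] c stirling_count[OF w, of c] cn by auto
      have w': "stirling (u @ v)" using w u by simp
      have "\<not> (u \<noteq> [] \<and> v \<noteq> [] \<and> (last u, hd v) \<in> A)"
      proof
        assume asm: "u \<noteq> [] \<and> v \<noteq> [] \<and> (last u, hd v) \<in> A"
        then have "last u < hd v" using A by (auto simp: ascents_def)
        then have "count_list u c = m c" using count_ascent_bottom[OF w'] asm u c cn by auto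
        then show False using u c by simp
      qed
      then obtain k p where kp: "(k, p) \<in> face_clique (u @ v) A" "agrees (k, p) u"
        "u \<noteq> [] \<Longrightarrow> last u \<le> k"
        "\<And>i. 1 \<le> i \<Longrightarrow> i \<le> n \<Longrightarrow> 0 < count_list u i \<Longrightarrow> count_list u i < m i \<Longrightarrow> k \<le> i"
        using face_clique_ex[OF w'] by metis
      \<comment> \<open>The letter \<open>c\<close> is open at this cut, so
        \<open>k \<le> c\<close>; it is also the last letter read, so
        \<open>c \<le> k\<close>.\<close>
      have "k = c" using kp(3) kp(4)[of c] u c cn by auto
      then show ?thesis using kp(1,2) agreesD[OF kp(2), of c] u c cn by auto
    qed
  qed
qed

text \<open>The prefix before the \<open>a\<close>-block has the right number of \<open>c\<close>s,
  but its cut may be an ascent of \<open>A\<close> and its route may enter below \<open>c\<close>.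
  It is shortened to end in its last letter \<open>d \<ge> c\<close>: the count of \<open>c\<close>
  is unchanged, the next letter is below \<open>c\<close>, so the cut is not an ascent, and the
  route enters at \<open>d\<close> or above.\<close>

lemma lo_face_clique:
  assumes w: "stirling w" and A: "A \<subseteq> ascents w" and ac: "1 \<le> a" "a < c" "c \<le> n"
  shows "lo (face_clique w A) c a = inv_num w c a"
proof -
  let ?K = "face_clique w A"
  interpret interior n m ?K by unfold_locales (rule interior_face_clique[OF w A])
  show ?thesis
  proof (rule antisym)
    obtain k p where p: "(k, p) \<in> ?K" "c \<le> k" "p a = 0" "p c = lo ?K c a"
      by (rule lo_ex[of a c]) (use ac in auto)
    obtain u v where u: "w = u @ v" "agrees (k, p) u" using p(1) by (rule face_cliqueE)
    have "count_list u a = 0" "count_list u c = lo ?K c a"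
      using agreesD[OF u(2), of a] agreesD[OF u(2), of c] p ac by auto
    then show "lo ?K c a \<le> inv_num w c a"
      using count_le_inv_num[of "{1..n}" m u v a c] w u ac m_pos[of a] by auto
    show "inv_num w c a \<le> lo ?K c a"
    proof (cases "inv_num w c a = 0")
      case False
      define x where "x = takeWhile (\<lambda>x. x \<noteq> a) w"
      have cx: "count_list x c = inv_num w c a" by (simp add: x_def inv_num_def)
      have ax: "a \<notin> set x" unfolding x_def by (auto dest: set_takeWhileD)
      have "c \<in> set x" using False cx count_notin[of c x] by (cases "c \<in> set x") auto
      then obtain x1 d x2
        where x: "x = x1 @ d # x2" "c \<le> d" "\<forall>y\<in>set x2. \<not> c \<le> y"
        using split_list_last_prop[of x "\<lambda>y. c \<le> y"] by blast
      define u where "u = x1 @ [d]"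
      define v where "v = x2 @ dropWhile (\<lambda>x. x \<noteq> a) w"
      have uv: "w = u @ v"
        using x takeWhile_dropWhile_id[of "\<lambda>x. x \<noteq> a" w]
          by (simp add: u_def v_def x_def)
      have w': "stirling (u @ v)" using w uv by simp
      have "c \<notin> set x2" using x by auto
      then have cu: "count_list u c = inv_num w c a" using cx x(1)
        by (simp add: u_def split: if_splits)
      have au: "count_list u a = 0" using ax x(1) by (simp add: u_def)
      have "hd v < c" if "v \<noteq> []"
      proof (cases "x2 = []")
        case True
        then have "hd v = a" using that hd_dropWhile[of "\<lambda>x. x \<noteq> a" w]
          by (simp add: v_def)
        then show ?thesis using ac by simp
      next
        case False
        then show ?thesis using x(3) by (simp add: v_def not_le)
      qed
      then have "\<not> (u \<noteq> [] \<and> v \<noteq> [] \<and> (last u, hd v) \<in> A)"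
        using A x(2) by (auto simp: ascents_def u_def)
      then obtain k p
        where kp: "(k, p) \<in> face_clique (u @ v) A" "agrees (k, p) u"
          "u \<noteq> [] \<Longrightarrow> last u \<le> k"
        using face_clique_ex[OF w'] by metis
      have "c \<le> k" using kp(3) x(2) by (simp add: u_def)
      then have "p a = 0" "p c = inv_num w c a"
        using agreesD[OF kp(2), of a] agreesD[OF kp(2), of c] au cu ac by auto
      then show ?thesis using lo_ge[of k p c a] kp(1) uv \<open>c \<le> k\<close> by simp
    qed simp
  qed
qed

text \<open>The prefix \<open>u\<close> ending inside the ascent is the only one containing all
  copies of \<open>a\<close> and exactly \<open>inv_num w c a\<close> copies of \<open>c\<close>. So
  a member with these two entries exists precisely when the cut at this ascent is allowed.\<close>

lemma hi_face_clique:
  assumes w: "stirling w" and A: "A \<subseteq> ascents w" and ac: "(a, c) \<in> ascents w"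
  shows "hi (face_clique w A) c a \<noteq> lo (face_clique w A) c a \<longleftrightarrow> (a, c) \<in> A"
proof -
  let ?K = "face_clique w A"
  interpret interior n m ?K by unfold_locales (rule interior_face_clique[OF w A])
  obtain u v where u: "w = u @ v" "u \<noteq> []" "v \<noteq> []" "last u = a" "hd v = c" "a < c"
    using ac by (rule ascentsE)
  have w': "stirling (u @ v)" using w u by simp
  have an: "1 \<le> a" "a \<le> n" "c \<le> n"
    using stirling_set[OF w, of a] stirling_set[OF w, of c] u by auto
  have cnt: "count_list u a = m a" "count_list u c = inv_num w c a"
    using count_ascent_bottom[OF w'] inv_num_last[OF w', of a c] u an by auto
  have lo: "lo ?K c a = inv_num w c a" by (rule lo_face_clique[OF w A]) (use u an in auto)
  show ?thesis
  proof
    assume A': "(a, c) \<in> A"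
    obtain k p where p: "(k, p) \<in> ?K" "c \<le> k" "p a = m a" "p c = hi ?K c a"
      by (rule hi_ex[of a c]) (use u an in auto)
    obtain u' v'
      where u': "w = u' @ v'" "agrees (k, p) u'"
        "\<not> (u' \<noteq> [] \<and> v' \<noteq> [] \<and> (last u', hd v') \<in> A)"
      using p(1) by (rule face_cliqueE)
    show "hi ?K c a \<noteq> lo ?K c a"
    proof
      assume "hi ?K c a = lo ?K c a"
      then have "count_list u' a = m a" "count_list u' c = inv_num w c a"
        using agreesD[OF u'(2), of a] agreesD[OF u'(2), of c] p an u lo by auto
      then have "u' = u" using prefix_eqI[of u v u' v'] u u'(1) cnt by simp
      then show False using u' u A' by auto
    qed
  next
    assume ne: "hi ?K c a \<noteq> lo ?K c a"
    show "(a, c) \<in> A"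
    proof (rule ccontr)
      assume "(a, c) \<notin> A"
      then have "\<not> (u \<noteq> [] \<and> v \<noteq> [] \<and> (last u, hd v) \<in> A)" using u
        by simp
      then obtain k p
        where kp: "(k, p) \<in> face_clique (u @ v) A" "agrees (k, p) u"
          "v \<noteq> [] \<Longrightarrow> hd v \<le> k"
        using face_clique_ex[OF w'] by metis
      then have "p a = m a" "p c = inv_num w c a" "c \<le> k"
        using agreesD[OF kp(2), of a] agreesD[OF kp(2), of c] u an cnt by auto
      then have "hi ?K c a \<le> lo ?K c a" using hi_le[of k p c a] kp(1) u lo by simp
      then show False using lo_le_hi[of a c] ne u an by simp
    qed
  qed
qed

end

section \<open>Minimality of the upper bound among transitive functions\<close>

context interior
begin

text \<open>On the letters up to \<open>k\<close> the entries satisfy \<open>fits_inv\<close>: the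
  upper bounds are those of \<open>lo\<close>, the lower ones follow from
  \<open>lo \<le> hi\<close>. Larger letters are left free, hence the set \<open>T\<close>.\<close>

lemma prefix_of_mem:
  assumes w: "stirling w"
    and inv: "\<And>a c. 1 \<le> a \<Longrightarrow> a < c \<Longrightarrow> c \<le> n \<Longrightarrow> inv_num w c a = lo K c a"
    and p: "(k, p) \<in> K"
  obtains u v where "w = u @ v" "agrees (k, p) u"
proof -
  define T where "T = {1..min k n}"
  have T: "T \<subseteq> {1..n}" by (auto simp: T_def)
  have le: "p i \<le> m i" if "i \<in> T" for i using KD(6)[OF p] that by (auto simp: T_def)
  have "fits_inv T m (inv_num w) p"
    unfolding fits_inv_def
  proof (intro ballI impI conjI)
    fix a c assume ac: "a \<in> T" "c \<in> T" "a < c"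
    then have a: "1 \<le> a" "a < k" "c \<le> k" "c \<le> n" by (auto simp: T_def)
    have p01: "p a = 0 \<or> p a = m a" using KD(5)[OF p] a by auto
    show "p c \<le> inv_num w c a" if "p a < m a"
      using lo_ge[OF p, of c a] inv[of a c] p01 that a ac by auto
    show "inv_num w c a \<le> p c" if "0 < p a"
      using hi_le[OF p, of c a] lo_le_hi[of a c] inv[of a c] p01 that a ac by auto
  qed
  then obtain u v where "w = u @ v" "\<And>i. i \<in> T \<Longrightarrow> count_list u i = p i"
    using fits_inv_is_prefix[OF w T le] by metis
  then show thesis using that[of u v] by (auto simp: agrees_def T_def)
qed

text \<open>If the letters \<open>x\<close> and \<open>y\<close> around the cut are equal, a member
  enters at \<open>x\<close> with the right entry because every source edge is met. If
  \<open>y < x\<close>, the member attaining \<open>lo K x y\<close> has the right entry at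
  \<open>x\<close> and 0 at \<open>y\<close>. In both cases the prefix of that member must be
  \<open>u\<close> by \<open>prefix_eqI\<close>.\<close>

lemma mem_if_no_ascent:
  assumes w: "stirling (u @ v)"
    and inv: "\<And>a c. 1 \<le> a \<Longrightarrow> a < c \<Longrightarrow> c \<le> n \<Longrightarrow> inv_num (u @ v) c a = lo K c a"
    and uv: "u \<noteq> []" "v \<noteq> []" "hd v \<le> last u"
  obtains k p where "(k, p) \<in> K" "agrees (k, p) u" "last u \<le> k"
proof -
  define x y where "x = last u" and "y = hd v"
  have xy: "1 \<le> x" "x \<le> n" "1 \<le> y" "y \<le> n" "y \<le> x"
    using stirling_set[OF w, of x] stirling_set[OF w, of y] uv by (auto simp: x_def y_def)
  have x0: "0 < count_list u x"
    using uv(1) by (cases u rule: rev_cases) (auto simp: x_def)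
  obtain v' where v: "v = y # v'" using uv(2) by (cases v) (auto simp: y_def)
  have y1: "count_list u y < m y"
    using stirling_count[OF w, of y] xy v by simp
  have "\<exists>k p. (k, p) \<in> K \<and> x \<le> k \<and> p x = count_list u x \<and> p y \<le> count_list u y"
  proof (cases "x = y")
    case True
    obtain p where "(x, p) \<in> K" "p x = count_list u x"
      using hit[of x "count_list u x"] x0 y1 xy True by auto
    then show ?thesis using True by (intro exI[of _ x] exI[of _ p]) simp
  next
    case False
    then have "y < x" using xy by simp
    then have "lo K x y = count_list u x"
      using inv[of y x] inv_num_next[of "{1..n}" m u y v' x] w v xy by auto
    moreover obtain k p where "(k, p) \<in> K" "x \<le> k" "p y = 0" "p x = lo K x y"
      by (rule lo_ex[of y x]) (use xy \<open>y < x\<close> in auto)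
    ultimately show ?thesis by (intro exI[of _ k] exI[of _ p]) auto
  qed
  then obtain k p
    where p: "(k, p) \<in> K" "x \<le> k" "p x = count_list u x" "p y \<le> count_list u y" by blast
  obtain u' v' where u': "u @ v = u' @ v'" "agrees (k, p) u'"
    using prefix_of_mem[OF w inv p(1)] by blast
  have "u' = u"
    using prefix_eqI[OF u'(1) uv(1,2)] agreesD[OF u'(2), of x] agreesD[OF u'(2), of y] p xy
    by (simp add: x_def y_def)
  then show thesis using that p u' by (simp add: x_def)
qed

text \<open>The induction treats \<open>a\<close> after all letters whose blocks end further right.
  If \<open>hi\<close> exceeds \<open>lo\<close> at \<open>(a, c)\<close>, the letter after the
  \<open>a\<close>-block shows why \<open>J\<close> must increase too: the ascent is
  \<open>(a, c)\<close> itself, or there is an intermediate letter \<open>e\<close> with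
  \<open>J e a\<close> nonzero, across which transitivity carries the bound from
  \<open>(e, c)\<close> to \<open>(a, c)\<close>. If the letter exceeds \<open>c\<close>, there can
  be no increase at all.\<close>

lemma hi_least:
  assumes w: "stirling w"
    and inv: "\<And>a c. 1 \<le> a \<Longrightarrow> a < c \<Longrightarrow> c \<le> n \<Longrightarrow> inv_num w c a = lo K c a"
    and J: "inv_transitive n J"
    and lo: "\<And>a c. 1 \<le> a \<Longrightarrow> a < c \<Longrightarrow> c \<le> n \<Longrightarrow> lo K c a \<le> J c a"
    and asc: "\<And>a c. (a, c) \<in> ascents w \<Longrightarrow> hi K c a \<noteq> lo K c a \<Longrightarrow> lo K c a + 1 \<le> J c a"
    and c: "c \<le> n"
  shows "1 \<le> a \<Longrightarrow> a < c \<Longrightarrow> hi K c a \<le> J c a"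
proof -
  have main: "hi K c a \<le> J c a"
    if "w = u @ v" "u \<noteq> []" "last u = a" "count_list u a = m a" "1 \<le> a" "a < c" for u v a
    using that
  proof (induction "length v" arbitrary: u v a rule: less_induct)
    case less
    note u = less.prems(1-4) and a = less.prems(5,6)
    have w': "stirling (u @ v)" using w u by simp
    have inv': "\<And>a c. 1 \<le> a \<Longrightarrow> a < c \<Longrightarrow> c \<le> n \<Longrightarrow> inv_num (u @ v) c a = lo K c a"
      using inv u(1) by simp
    have cnt: "count_list u d = lo K d a" if "a < d" "d \<le> n" for d
      using inv_num_last[OF w' u(2,3), of d] inv'[of a d] that a c by auto
    show ?case
    proof (cases "hi K c a = lo K c a")
      case True
      then show ?thesis using lo[of a c] a c by simp
    next
      case False
      then have gt: "lo K c a < hi K c a" using lo_le_hi[of a c] a c by simp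
      \<comment> \<open>A member of this kind reaching \<open>c\<close> would put
        \<open>lo K c a\<close> among the values whose minimum is \<open>hi K c a\<close>.\<close>
      have not: "k < c"
        if "(k, p) \<in> K" "agrees (k, p) u'" "count_list u' a = m a" "count_list u' c = lo K c a"
          for k p u'
      proof (rule ccontr)
        assume "\<not> k < c"
        then have "p a = m a" "p c = lo K c a"
          using agreesD[OF that(2), of a] agreesD[OF that(2), of c] that a c by auto
        then show False using hi_le[OF that(1), of c a] gt \<open>\<not> k < c\<close> by simp
      qed
      \<comment> \<open>Since \<open>e\<close> is not exhausted where the \<open>a\<close>-block
        ends, its own block ends later and the induction hypothesis applies to
        \<open>e\<close>.\<close>
      have via: ?thesis if e: "a < e" "e < c" "J e a \<noteq> 0" "count_list u e < m e" for e
      proof -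
        obtain u1 v1 where u1: "w = u1 @ v1" "u1 \<noteq> []" "last u1 = e" "count_list u1 e = m e"
          using block_end[OF w, of e] e a c by auto
        have "length u < length u1"
        proof (rule ccontr)
          assume "\<not> ?thesis"
          moreover have "u @ v = u1 @ v1" using u(1) u1(1) by simp
          ultimately obtain z where "u = u1 @ z" by (auto simp: append_eq_append_conv2)
          then show False using e(4) u1(4) by simp
        qed
        then have "length v1 < length v"
          using arg_cong[OF trans[OF u(1)[symmetric] u1(1)], of length] by simp
        then have "hi K c e \<le> J c e" using less.hyps[of v1 u1 e] u1 e a by auto
        moreover have "J c e \<le> J c a"
          using J[unfolded inv_transitive_def, rule_format, of a e c] e a c by simp
        \<comment> \<open>The member attaining \<open>hi K c e\<close> has exhausted
          \<open>e\<close>, so its prefix extends beyond \<open>u\<close> and has exhausted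
          \<open>a\<close>; it is thus a candidate for \<open>hi K c a\<close>.\<close>
        moreover have "hi K c a \<le> hi K c e"
        proof -
          obtain l q where q: "(l, q) \<in> K" "c \<le> l" "q e = m e" "q c = hi K c e"
            by (rule hi_ex[of e c]) (use e a c in auto)
          obtain u2 v2 where u2: "w = u2 @ v2" "agrees (l, q) u2" using prefix_of_mem[OF w inv q(1)]
            by blast
          have ce: "count_list u e < count_list u2 e" using agreesD[OF u2(2), of e] q e a c by auto
          have "u @ v = u2 @ v2" using u u2 by simp
          then consider z where "u2 = u @ z" | z where "u = u2 @ z"
            by (auto simp: append_eq_append_conv2)
          then obtain z where "u2 = u @ z" using ce by cases auto
          then have "count_list u2 a = m a"
            using u(4) count_prefix_le[of "{1..n}" m u2 v2 a] w u2(1) a c by auto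
          then have "q a = m a" using agreesD[OF u2(2), of a] q a c by auto
          then show ?thesis using hi_le[OF q(1,2)] q by simp
        qed
        ultimately show ?thesis by simp
      qed
      \<comment> \<open>By \<open>not\<close> this member enters at some \<open>k < c\<close>. Its
        source edge shows that \<open>k\<close> is begun but unfinished in \<open>u\<close>, so
        \<open>lo K k a > 0\<close> and \<open>k\<close> can serve as the intermediate
        letter.\<close>
      have viaK: ?thesis if k: "(k, p) \<in> K" "agrees (k, p) u" "a \<le> k" for k p
      proof -
        have kc: "k < c" using not[OF k(1,2)] u(4) cnt[of c] a c by simp
        then have pk: "p k = count_list u k" using agreesD[OF k(2), of k] k a c by auto
        then have k2: "0 < count_list u k" "count_list u k < m k" using KD(3,4)[OF k(1)] by auto
        then have ak: "a < k" using u(4) k(3) by (cases "a = k") auto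
        have "J k a \<noteq> 0" using lo[of a k] cnt[of k] k2 ak kc a c by auto
        then show ?thesis using via[of k] ak kc k2 by simp
      qed
      have "lo K c a < m c" using gt hi_le_m[of a c] a c by simp
      then have cv: "c \<in> set v"
        using stirling_count[OF w', of c] cnt[of c] a c count_notin[of c v]
          by (cases "c \<in> set v") auto
      then obtain y v' where v: "v = y # v'" by (cases v) auto
      have yn: "1 \<le> y" "y \<le> n" using stirling_set[OF w', of y] v by auto
      have ym: "count_list u y < m y" using stirling_count[OF w', of y] yn v by simp
      then have "y \<noteq> a" using u(4) by auto
      then consider "y < a" | "y = c" | "a < y" "y < c" | "c < y" by linarith
      then show ?thesis
      proof cases
        case 1
        obtain k p where "(k, p) \<in> K" "agrees (k, p) u" "last u \<le> k"
          using mem_if_no_ascent[OF w' inv' u(2)] v 1 u(3) by auto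
        then show ?thesis using viaK u(3) by simp
      next
        case 2
        have "(a, c) \<in> ascents w"
          using ascents_appendI[of u v] u v 2 a by simp
        then show ?thesis using asc[of a c] False hi_le_lo[of a c] a c by simp
      next
        case 3
        show ?thesis
        proof (cases "hi K y a = lo K y a")
          case False
          have "(a, y) \<in> ascents w" using ascents_appendI[of u v] u v 3 by simp
          then have "J y a \<noteq> 0" using asc[of a y] False by auto
          then show ?thesis using via[of y] 3 ym by simp
        next
          case True
          \<comment> \<open>Without an increase at \<open>(a, y)\<close>, the member attaining
            \<open>hi K y a\<close> has the same counts of \<open>a\<close> and \<open>y\<close> as
            \<open>u\<close>, hence agrees with \<open>u\<close> itself.\<close>
          obtain l q where q: "(l, q) \<in> K" "y \<le> l" "q a = m a" "q y = hi K y a"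
            by (rule hi_ex[of a y]) (use 3 a yn in auto)
          obtain u2 v2 where u2: "w = u2 @ v2" "agrees (l, q) u2" using prefix_of_mem[OF w inv q(1)]
            by blast
          have "count_list u2 a = m a" "count_list u2 y = count_list u y"
            using agreesD[OF u2(2), of a] agreesD[OF u2(2), of y] q 3 a yn True cnt[of y] by auto
          then have "u2 = u" using prefix_eqI[of u v u2 v2] u u2(1) v by simp
          then show ?thesis using viaK[OF q(1)] u2 q(2) 3 by simp
        qed
      next
        case 4
        \<comment> \<open>Skipping the letters above \<open>c\<close> changes neither the count of
          \<open>a\<close> nor that of \<open>c\<close>. It leads to a cut that is not an ascent and
          whose last letter exceeds \<open>c\<close>, so a member reaching beyond \<open>c\<close>
          agrees with it, against \<open>not\<close>.\<close>
        define v1 v2 where "v1 = takeWhile (\<lambda>x. c < x) v"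
          and "v2 = dropWhile (\<lambda>x. c < x) v"
        have v12: "v = v1 @ v2" by (simp add: v1_def v2_def)
        have v1: "v1 \<noteq> []" "\<forall>x\<in>set v1. c < x" using v 4
          by (auto simp: v1_def dest: set_takeWhileD)
        have v2: "v2 \<noteq> []" using cv v1(2) v12 by auto
        then have hd2: "\<not> c < hd v2" unfolding v2_def by (metis hd_dropWhile)
        have last1: "c < last (u @ v1)" using v1 by simp
        have w1: "stirling ((u @ v1) @ v2)" using w' v12 by simp
        have inv1: "\<And>a c. 1 \<le> a \<Longrightarrow> a < c \<Longrightarrow> c \<le> n \<Longrightarrow> inv_num ((u @ v1) @ v2) c a = lo K c a"
          using inv' v12 by simp
        obtain k p where kp: "(k, p) \<in> K" "agrees (k, p) (u @ v1)" "last (u @ v1) \<le> k"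
        proof (rule mem_if_no_ascent[OF w1 inv1 _ v2])
          show "hd v2 \<le> last (u @ v1)" using hd2 last1 by simp
        qed (use v1 in auto)
        have "count_list (u @ v1) a = m a" "count_list (u @ v1) c = lo K c a"
          using u(4) cnt[of c] v1(2) a c by (auto simp: count_list_0_iff)
        then show ?thesis using not[OF kp(1,2)] kp(3) last1 by simp
      qed
    qed
  qed
  show "hi K c a \<le> J c a" if a: "1 \<le> a" "a < c"
  proof -
    obtain u v where "w = u @ v" "u \<noteq> []" "last u = a" "count_list u a = m a"
      using block_end[OF w, of a] a c by auto
    then show ?thesis using main a by blast
  qed
qed

end

section \<open>Cliques and faces of the permutahedron\<close>

context multiplicities
begin

definition face_word :: "(nat \<times> (nat \<Rightarrow> nat)) set \<Rightarrow> nat list" where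
  "face_word K = (THE w. stirling w \<and> (\<forall>a c. 1 \<le> a \<and> a < c \<and> c \<le> n \<longrightarrow> inv_num w c a = lo K c a))"

definition face_top :: "(nat \<times> (nat \<Rightarrow> nat)) set \<Rightarrow> nat list" where
  "face_top K = (THE w. stirling w \<and> (\<forall>a c. 1 \<le> a \<and> a < c \<and> c \<le> n \<longrightarrow> inv_num w c a = hi K c a))"

definition face_asc :: "(nat \<times> (nat \<Rightarrow> nat)) set \<Rightarrow> (nat \<times> nat) set" where
  "face_asc K = {(a, c) \<in> ascents (face_word K). hi K c a \<noteq> lo K c a}"

lemma stirling_eqI:
  assumes "stirling w" "stirling w'"
    "\<And>a c. 1 \<le> a \<Longrightarrow> a < c \<Longrightarrow> c \<le> n \<Longrightarrow> inv_num w c a = inv_num w' c a"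
  shows "w = w'"
  by (rule stirling_on_eqI[of "{1..n}" m]) (use assms in auto)

lemma stirling_ex1:
  assumes "\<And>a c. 1 \<le> a \<Longrightarrow> a < c \<Longrightarrow> c \<le> n \<Longrightarrow> I c a \<le> m c"
    and "\<And>a b c. 1 \<le> a \<Longrightarrow> a < b \<Longrightarrow> b < c \<Longrightarrow> c \<le> n \<Longrightarrow> I b a = 0 \<or> I c b \<le> I c a"
    and "\<And>a b c. 1 \<le> a \<Longrightarrow> a < b \<Longrightarrow> b < c \<Longrightarrow> c \<le> n \<Longrightarrow> I b a = m b \<or> I c a \<le> I c b"
  shows "\<exists>!w. stirling w \<and> (\<forall>a c. 1 \<le> a \<and> a < c \<and> c \<le> n \<longrightarrow> inv_num w c a = I c a)"
proof (rule ex_ex1I)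
  have "\<exists>w. stirling w \<and> (\<forall>a\<in>{1..n}. \<forall>c\<in>{1..n}. a < c \<longrightarrow> inv_num w c a = I c a)"
    by (rule stirling_on_exists) (use assms m_pos in auto)
  then obtain w
    where w: "stirling w"
      "\<forall>a\<in>{1..n}. \<forall>c\<in>{1..n}. a < c \<longrightarrow> inv_num w c a = I c a"
    by blast
  have "inv_num w c a = I c a" if "1 \<le> a \<and> a < c \<and> c \<le> n" for a c
    using w(2)[rule_format, of a c] that by simp
  then show "\<exists>w. stirling w \<and> (\<forall>a c. 1 \<le> a \<and> a < c \<and> c \<le> n \<longrightarrow> inv_num w c a = I c a)"
    using w(1) by blast
next
  fix w w'
  assume "stirling w \<and> (\<forall>a c. 1 \<le> a \<and> a < c \<and> c \<le> n \<longrightarrow> inv_num w c a = I c a)"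
    "stirling w' \<and> (\<forall>a c. 1 \<le> a \<and> a < c \<and> c \<le> n \<longrightarrow> inv_num w' c a = I c a)"
  then show "w = w'" by (intro stirling_eqI) auto
qed

end

context interior
begin

lemma face_word: "stirling (face_word K)"
  and inv_face_word: "1 \<le> a \<Longrightarrow> a < c \<Longrightarrow> c \<le> n \<Longrightarrow> inv_num (face_word K) c a = lo K c a"
  using theI'[OF stirling_ex1[of "lo K", OF lo_le lo_trans lo_planar]]
  by (auto simp: face_word_def)

lemma face_top: "stirling (face_top K)"
  and inv_face_top: "1 \<le> a \<Longrightarrow> a < c \<Longrightarrow> c \<le> n \<Longrightarrow> inv_num (face_top K) c a = hi K c a"
  using theI'[OF stirling_ex1[of "hi K", OF hi_le_m hi_trans hi_planar]]
  by (auto simp: face_top_def)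

text \<open>This identifies the top word as \<open>w + A\<close>. The bound at the raised pairs
  holds because there \<open>lo \<le> hi\<close> is strict; minimality is
  \<open>hi_least\<close>.\<close>

lemma smallest_transitive_face_top:
  "is_smallest_transitive_above n
     (\<lambda>c a. inv_num (face_word K) c a + (if (a, c) \<in> face_asc K then 1 else 0)) (inv_num (face_top K))"
  unfolding is_smallest_transitive_above_def
proof (intro conjI allI impI)
  show "inv_transitive n (inv_num (face_top K))"
    unfolding inv_transitive_def
  proof (intro allI impI, elim conjE)
    fix a b c assume *: "1 \<le> a" "a < b" "b < c" "c \<le> n"
    show "inv_num (face_top K) b a = 0 \<or> inv_num (face_top K) c b \<le> inv_num (face_top K) c a"
      using hi_trans[OF *] inv_face_top * by simp
  qed
  show "inv_le n (\<lambda>c a. inv_num (face_word K) c a + (if (a, c) \<in> face_asc K then 1 else 0)) (inv_num (face_top K))"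
    unfolding inv_le_def
  proof (intro allI impI, elim conjE)
    fix a c assume *: "1 \<le> a" "a < c" "c \<le> n"
    show "inv_num (face_word K) c a + (if (a, c) \<in> face_asc K then 1 else 0) \<le> inv_num (face_top K) c a"
      using lo_le_hi[OF *] inv_face_top[OF *] inv_face_word[OF *] by (auto simp: face_asc_def)
  qed
  fix J assume "inv_transitive n J \<and>
    inv_le n (\<lambda>c a. inv_num (face_word K) c a + (if (a, c) \<in> face_asc K then 1 else 0)) J"
  then have J: "inv_transitive n J"
    and le: "\<And>a c. 1 \<le> a \<Longrightarrow> a < c \<Longrightarrow> c \<le> n \<Longrightarrow>
      inv_num (face_word K) c a + (if (a, c) \<in> face_asc K then 1 else 0) \<le> J c a"
    by (auto simp: inv_le_def)
  have lo: "lo K c a \<le> J c a" if "1 \<le> a" "a < c" "c \<le> n" for a c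
    using le[OF that] inv_face_word[OF that] by simp
  have asc: "lo K c a + 1 \<le> J c a"
    if *: "(a, c) \<in> ascents (face_word K)" "hi K c a \<noteq> lo K c a" for a c
  proof -
    have "(a, c) \<in> face_asc K" using that by (simp add: face_asc_def)
    obtain u v where "face_word K = u @ v" "u \<noteq> []" "v \<noteq> []" "last u = a" "hd v = c"
      "a < c"
      using *(1) by (rule ascentsE)
    then have ac: "1 \<le> a" "a < c" "c \<le> n"
      using stirling_set[OF face_word, of a] stirling_set[OF face_word, of c] by auto
    then show ?thesis using le[OF ac] inv_face_word[OF ac] \<open>(a, c) \<in> face_asc K\<close>
      by simp
  qed
  show "inv_le n (inv_num (face_top K)) J"
    unfolding inv_le_def
  proof (intro allI impI, elim conjE)
    fix a c assume *: "1 \<le> a" "a < c" "c \<le> n"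
    have "hi K c a \<le> J c a"
      by (rule hi_least[OF face_word inv_face_word J lo asc *(3,1,2)])
    then show "inv_num (face_top K) c a \<le> J c a" using inv_face_top[OF *] by simp
  qed
qed

text \<open>The only source edge at \<open>Suc n\<close> has value 1. This supplies the bounds at
  index \<open>Suc n\<close> that \<open>mem_if_between\<close> requires beyond those for
  letters.\<close>

lemma lo_hi_top: "1 \<le> a \<Longrightarrow> a \<le> n \<Longrightarrow> lo K (Suc n) a = 1 \<and> hi K (Suc n) a = 1"
proof -
  assume a: "1 \<le> a" "a \<le> n"
  obtain k p where p: "(k, p) \<in> K" "Suc n \<le> k" "p (Suc n) = lo K (Suc n) a"
    by (rule lo_ex[of a "Suc n"]) (use a in auto)
  obtain l q where q: "(l, q) \<in> K" "Suc n \<le> l" "q (Suc n) = hi K (Suc n) a"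
    by (rule hi_ex[of a "Suc n"]) (use a in auto)
  show ?thesis using KD(2,3,4)[OF p(1)] KD(2,3,4)[OF q(1)] p q m_top by auto
qed

end

context multiplicities
begin

text \<open>Enlarging a clique raises maxima and lowers minima. Conversely, the vectors of
  \<open>L\<close> respect the weaker bounds of \<open>K\<close> and are members of \<open>K\<close>
  by \<open>mem_if_between\<close>.\<close>

lemma clique_subset_iff:
  assumes K: "interior_clique K" and L: "interior_clique L"
  shows "L \<subseteq> K \<longleftrightarrow> (\<forall>a c. 1 \<le> a \<and> a < c \<and> c \<le> n \<longrightarrow> lo L c a \<le> lo K c a \<and> hi K c a \<le> hi L c a)"
proof -
  interpret K: interior n m K by unfold_locales fact
  interpret L: interior n m L by unfold_locales fact
  show ?thesis
  proof (intro iffI allI impI)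
    fix a c assume sub: "L \<subseteq> K" and ac: "1 \<le> a \<and> a < c \<and> c \<le> n"
    obtain k p where p: "(k, p) \<in> L" "c \<le> k" "p a = 0" "p c = lo L c a"
      by (rule L.lo_ex[of a c]) (use ac in auto)
    obtain l q where q: "(l, q) \<in> L" "c \<le> l" "q a = m a" "q c = hi L c a"
      by (rule L.hi_ex[of a c]) (use ac in auto)
    show "lo L c a \<le> lo K c a \<and> hi K c a \<le> hi L c a"
      using K.lo_ge[of k p c a] K.hi_le[of l q c a] p q sub by auto
  next
    assume le: "\<forall>a c. 1 \<le> a \<and> a < c \<and> c \<le> n \<longrightarrow> lo L c a \<le> lo K c a \<and> hi K c a \<le> hi L c a"
    have le': "lo L c a \<le> lo K c a \<and> hi K c a \<le> hi L c a"
      if "1 \<le> a" "a < c" "c \<le> Suc n" for a c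
      using le K.lo_hi_top[of a] L.lo_hi_top[of a] that by (cases "c = Suc n") auto
    show "L \<subseteq> K"
    proof (rule subrelI)
      fix k p assume p: "(k, p) \<in> L"
      have k: "k \<le> Suc n" using L.KD(2)[OF p] .
      show "(k, p) \<in> K"
      proof (rule K.mem_if_between[OF L.K_rvecs[OF p]])
        fix a c assume ac: "1 \<le> a" "a < c" "c \<le> k"
        show "p c \<le> lo K c a" if "p a = 0"
          using L.lo_ge[OF p ac(3) that] le'[of a c] ac k by simp
        show "hi K c a \<le> p c" if "p a = m a"
          using L.hi_le[OF p ac(3) that] le'[of a c] ac k by simp
      qed
    qed
  qed
qed

lemma face_clique_face:
  assumes w: "stirling w" and A: "A \<subseteq> ascents w"
  shows "face_word (face_clique w A) = w" "face_asc (face_clique w A) = A"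
proof -
  interpret interior n m "face_clique w A" by unfold_locales (rule interior_face_clique[OF w A])
  show *: "face_word (face_clique w A) = w"
    using face_word inv_face_word lo_face_clique[OF w A] w by (intro stirling_eqI) auto
  show "face_asc (face_clique w A) = A"
    using hi_face_clique[OF w A] A unfolding face_asc_def * by blast
qed

end

locale comp_list =
  fixes s :: "nat list" assumes comp: "composition s"

sublocale comp_list \<subseteq> multiplicities "length s" "spart s"
proof
  show "1 \<le> spart s i" if "1 \<le> i" "i \<le> length s" for i
    using comp that by (auto simp: composition_def spart_def nth_append)
  show "spart s (Suc (length s)) = 2" by (simp add: spart_def)
qed

context comp_list
begin

lemma add_ascents_face:
  assumes "interior_clique K"
  shows "add_ascents s (face_word K) (face_asc K) = face_top K"
proof -
  interpret interior "length s" "spart s" K by unfold_locales fact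
  show ?thesis
    unfolding add_ascents_def stirling_perm_iff
  proof (rule the_equality)
    let ?L = "\<lambda>c a. inv_num (face_word K) c a + (if (a, c) \<in> face_asc K then 1 else 0)"
    show "stirling (face_top K) \<and> is_smallest_transitive_above (length s) ?L (inv_num (face_top K))"
      using face_top smallest_transitive_face_top by blast
    fix w assume w: "stirling w \<and> is_smallest_transitive_above (length s) ?L (inv_num w)"
    have "inv_le (length s) (inv_num w) (inv_num (face_top K))"
      "inv_le (length s) (inv_num (face_top K)) (inv_num w)"
      using w smallest_transitive_face_top by (auto simp: is_smallest_transitive_above_def)
    then show "w = face_top K"
      using w face_top by (intro stirling_eqI) (auto simp: inv_le_def intro: antisym)
  qed
qed

text \<open>The interval consists of the words whose inversion numbers lie between \<open>lo\<close>
  and \<open>hi\<close>. It contains its two end words, and testing these reduces inclusion to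
  inequalities between the bounds.\<close>

lemma interval_subset_iff:
  assumes K: "interior_clique K" and L: "interior_clique L"
  shows "s_interval s (face_word K) (face_top K) \<subseteq> s_interval s (face_word L) (face_top L) \<longleftrightarrow> L \<subseteq> K"
proof -
  interpret K: interior "length s" "spart s" K by unfold_locales fact
  interpret L: interior "length s" "spart s" L by unfold_locales fact
  have in_iff: "u \<in> s_interval s (face_word M) (face_top M) \<longleftrightarrow> stirling u \<and>
      (\<forall>a c. 1 \<le> a \<and> a < c \<and> c \<le> length s \<longrightarrow> lo M c a \<le> inv_num u c a \<and> inv_num u c a \<le> hi M c a)"
    if "interior_clique M" for u M
  proof -
    interpret M: interior "length s" "spart s" M by unfold_locales fact
    show ?thesis
      using M.inv_face_word M.inv_face_top
      by (auto simp: s_interval_def s_weak_le_def inv_le_def stirling_perm_iff)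
  qed
  show ?thesis
    unfolding clique_subset_iff[OF K L]
  proof
    assume sub: "s_interval s (face_word K) (face_top K) \<subseteq> s_interval s (face_word L) (face_top L)"
    have "face_word K \<in> s_interval s (face_word K) (face_top K)"
      "face_top K \<in> s_interval s (face_word K) (face_top K)"
      using K.face_word K.face_top K.inv_face_word K.inv_face_top K.lo_le_hi
      by (auto simp: in_iff[OF K])
    then have "face_word K \<in> s_interval s (face_word L) (face_top L)"
      "face_top K \<in> s_interval s (face_word L) (face_top L)" using sub by auto
    then show "\<forall>a c. 1 \<le> a \<and> a < c \<and> c \<le> length s \<longrightarrow> lo L c a \<le> lo K c a \<and> hi K c a \<le> hi L c a"
      using K.inv_face_word K.inv_face_top by (auto simp: in_iff[OF L])
  next
    assume "\<forall>a c. 1 \<le> a \<and> a < c \<and> c \<le> length s \<longrightarrow> lo L c a \<le> lo K c a \<and> hi K c a \<le> hi L c a"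
    then show "s_interval s (face_word K) (face_top K) \<subseteq> s_interval s (face_word L) (face_top L)"
      unfolding subset_iff in_iff[OF K] in_iff[OF L] by (meson le_trans)
  qed
qed

definition clique_face :: "(nat \<times> (nat \<Rightarrow> nat)) set \<Rightarrow> nat list \<times> (nat \<times> nat) set" where
  "clique_face K = (face_word K, face_asc K)"

lemma clique_face_le_iff:
  assumes "interior_clique K" "interior_clique L"
  shows "perm_face_le s (clique_face K) (clique_face L) \<longleftrightarrow> L \<subseteq> K"
  using assms by (simp add: clique_face_def add_ascents_face interval_subset_iff)

text \<open>Injectivity comes from the order: equal faces lie below each other, so their cliques
  contain each other. Surjectivity is witnessed by \<open>face_clique\<close>.\<close>

lemma bij_betw_clique_face: "bij_betw clique_face {K. interior_clique K} (perm_faces s)"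
  unfolding bij_betw_def
proof (intro conjI)
  show "inj_on clique_face {K. interior_clique K}"
  proof (rule inj_onI)
    fix K L assume KL: "K \<in> {K. interior_clique K}" "L \<in> {K. interior_clique K}"
      "clique_face K = clique_face L"
    then have "perm_face_le s (clique_face K) (clique_face L)"
      "perm_face_le s (clique_face L) (clique_face K)"
      using clique_face_le_iff[of K K] clique_face_le_iff[of L L] by auto
    then show "K = L"
      using KL clique_face_le_iff[of K L] clique_face_le_iff[of L K] by auto
  qed
  show "clique_face ` {K. interior_clique K} = perm_faces s"
  proof (intro equalityI subsetI)
    fix f assume "f \<in> clique_face ` {K. interior_clique K}"
    then obtain K where "interior_clique K" and f: "f = clique_face K" by auto
    interpret interior "length s" "spart s" K by unfold_locales fact
    show "f \<in> perm_faces s"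
      using face_word f
        by (auto simp: perm_faces_def clique_face_def stirling_perm_iff face_asc_def)
  next
    fix f assume "f \<in> perm_faces s"
    then obtain w A where f: "f = (w, A)" "stirling w" "A \<subseteq> ascents w"
      by (auto simp: perm_faces_def stirling_perm_iff)
    have "f = clique_face (face_clique w A)"
      using face_clique_face[OF f(2,3)] f(1) by (simp add: clique_face_def)
    then show "f \<in> clique_face ` {K. interior_clique K}"
      using interior_face_clique[OF f(2,3)] by blast
  qed
qed

end

section \<open>Routes of the graph as vectors\<close>

context comp_list
begin

fun edges_of :: "nat \<times> (nat \<Rightarrow> nat) \<Rightarrow> edge list" where
  "edges_of (k, p) = map (\<lambda>i. (i, p i)) (rev [1..<Suc k])"

declare edges_of.simps [simp del]

definition delta_of :: "nat \<Rightarrow> (nat \<Rightarrow> nat) \<Rightarrow> nat \<Rightarrow> nat" where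
  "delta_of k p = (\<lambda>i\<in>{1..<k}. if p i = 0 then 0 else 1)"

definition vec_of :: "nat \<Rightarrow> nat \<Rightarrow> (nat \<Rightarrow> nat) \<Rightarrow> nat \<Rightarrow> nat" where
  "vec_of k t \<delta> i = (if i = k then t else if 1 \<le> i \<and> i < k then \<delta> i * spart s i else 0)"

lemma delta_of_deltas: "delta_of k p \<in> deltas k"
  by (auto simp: delta_of_def deltas_def)

lemma edges_of_eq_route:
  assumes "(k, p) \<in> rvecs"
  shows "edges_of (k, p) = route s k (p k) (delta_of k p)"
proof -
  have "rev [1..<Suc k] = k # rev [1..<k]" using rvecsD(1)[OF assms] by simp
  moreover have "p i = delta_of k p i * spart s i" if "i \<in> set (rev [1..<k])" for i
    using that rvecsD(5)[OF assms, of i] by (auto simp: delta_of_def)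
  ultimately show ?thesis by (simp add: route_def edges_of.simps)
qed

lemma vec_of_rvecs:
  assumes "1 \<le> k" "k \<le> length s + 1" "1 \<le> t" "t \<le> spart s k - 1"
    "\<delta> \<in> deltas k"
  shows "(k, vec_of k t \<delta>) \<in> rvecs"
proof -
  have "\<delta> i = 0 \<or> \<delta> i = 1" if "1 \<le> i" "i < k" for i
    using PiE_mem[OF assms(5)[unfolded deltas_def], of i] that by auto
  then have "\<forall>i\<in>{1..<k}. vec_of k t \<delta> i = 0 \<or> vec_of k t \<delta> i = spart s i"
    by (fastforce simp: vec_of_def)
  then show ?thesis using assms(1-4) by (auto simp: rvecs_def vec_of_def)
qed

lemma delta_of_vec_of:
  assumes "1 \<le> k" "k \<le> length s + 1" "\<delta> \<in> deltas k"
  shows "delta_of k (vec_of k t \<delta>) = \<delta>"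
proof (rule PiE_ext[OF delta_of_deltas[unfolded deltas_def] assms(3)[unfolded deltas_def]])
  fix i assume i: "i \<in> {1..<k}"
  have "\<delta> i = 0 \<or> \<delta> i = 1" using PiE_mem[OF assms(3)[unfolded deltas_def] i]
    by auto
  then show "delta_of k (vec_of k t \<delta>) i = \<delta> i"
    using i m_pos[of i] assms by (auto simp: delta_of_def vec_of_def)
qed

lemma routes_eq: "routes s = edges_of ` rvecs"
proof (intro equalityI subsetI)
  fix R assume "R \<in> routes s"
  then obtain k t \<delta> where R: "R = route s k t \<delta>"
    and k: "1 \<le> k" "k \<le> length s + 1" "1 \<le> t" "t \<le> spart s k - 1"
      "\<delta> \<in> deltas k"
    by (auto simp: routes_def)
  have "edges_of (k, vec_of k t \<delta>) = route s k t \<delta>"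
    using edges_of_eq_route[OF vec_of_rvecs[OF k]] delta_of_vec_of[OF k(1,2,5)]
      by (simp add: vec_of_def)
  then show "R \<in> edges_of ` rvecs" using vec_of_rvecs[OF k] R by (metis image_eqI)
next
  fix R assume "R \<in> edges_of ` rvecs"
  then obtain k p where R: "R = edges_of (k, p)" and p: "(k, p) \<in> rvecs" by auto
  have "R = route s k (p k) (delta_of k p)" "1 \<le> k" "k \<le> length s + 1" "1 \<le> p k"
    "p k \<le> spart s k - 1"
    "delta_of k p \<in> deltas k"
    using R edges_of_eq_route[OF p] rvecsD(1-4)[OF p] delta_of_deltas by auto
  then show "R \<in> routes s" unfolding routes_def by blast
qed

lemma set_edges_of: "set (edges_of (k, p)) = (\<lambda>i. (i, p i)) ` {1..k}"
  by (auto simp: edges_of.simps atLeastLessThanSuc_atLeastAtMost)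

text \<open>The source edge of \<open>P\<close> lies strictly between bump and dip, so it can only
  be the source edge of \<open>Q\<close>; hence both routes have the same length.\<close>

lemma edges_of_subset:
  assumes "P \<in> rvecs" "Q \<in> rvecs" "set (edges_of P) \<subseteq> set (edges_of Q)"
  shows "P = Q"
proof -
  obtain k p l q where PQ: "P = (k, p)" "Q = (l, q)" by (cases P, cases Q)
  have p: "(k, p) \<in> rvecs" and q: "(l, q) \<in> rvecs" using assms PQ by auto
  have eq: "i \<le> l \<and> p i = q i" if "1 \<le> i" "i \<le> k" for i
  proof -
    have "(i, p i) \<in> set (edges_of (k, p))" unfolding set_edges_of using that by auto
    then have "(i, p i) \<in> set (edges_of (l, q))" using assms(3) PQ by auto
    then show ?thesis unfolding set_edges_of by auto
  qed
  have "k = l"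
    using eq[of k] rvecsD(1,3,4)[OF p] rvecsD(5)[OF q, of k] by (cases "k = l") auto
  moreover have "p = q"
    by (rule rvecs_eqI[OF p]) (use q \<open>k = l\<close> in simp, use eq in blast)
  ultimately show ?thesis using PQ by simp
qed

lemma inj_on_edges_of: "inj_on edges_of rvecs"
  by (rule inj_onI) (simp add: edges_of_subset)

lemma nth_edges_of: "a < k \<Longrightarrow> edges_of (k, p) ! a = (k - a, p (k - a))"
  by (simp add: edges_of.simps rev_nth Suc_diff_Suc del: upt_Suc)

lemma length_edges_of: "length (edges_of (k, p)) = k"
  by (simp add: edges_of.simps)

text \<open>Bump and dip at \<open>i\<close> leave the same vertex, so the edges by which two routes
  pass \<open>i\<close> are always comparable in the framing of outgoing edges.\<close>

lemma edge_src_rvec: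
  assumes "(k, p) \<in> rvecs" "1 \<le> i" "i < k"
  shows "edge_src s (i, p i) = int (length s) - int i"
  using rvecsD(5)[OF assms] by auto

lemma edges_of_split:
  assumes "1 \<le> i" "i < j" "j \<le> k"
  shows "edges_of (k, p) = map (\<lambda>i. (i, p i)) (rev [j..<Suc k]) @
    map (\<lambda>i. (i, p i)) (rev [Suc i..<j]) @ map (\<lambda>i. (i, p i)) (rev [1..<Suc i])"
proof -
  have "[1..<Suc k] = [1..<Suc i] @ [Suc i..<j] @ [j..<Suc k]"
    using assms upt_add_eq_append[of 1 "Suc i" "k - i"] upt_add_eq_append[of "Suc i" j "Suc k - j"]
    by (simp del: upt_Suc)
  then have "rev [1..<Suc k] = rev [j..<Suc k] @ rev [Suc i..<j] @ rev [1..<Suc i]"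
    by (simp only: rev_append append_assoc)
  then show ?thesis by (simp only: edges_of.simps map_append)
qed

text \<open>A maximal common subpath between inner vertices corresponds to indices
  \<open>i < j\<close> where the vectors differ while agreeing strictly between; coherence says that
  both differences have the same sign. For incomparable routes, two opposite differences at minimal
  distance have equal entries between them and so violate coherence.\<close>

lemma coherent_iff_comparable:
  assumes P: "(k, p) \<in> rvecs" and Q: "(l, q) \<in> rvecs"
  shows "coherent s (edges_of (k, p)) (edges_of (l, q)) \<longleftrightarrow> comparable (k, p) (l, q)"
proof
  assume comp: "comparable (k, p) (l, q)"
  show "coherent s (edges_of (k, p)) (edges_of (l, q))"
    unfolding coherent_def
  proof (intro allI impI, elim conjE)
    fix p1 q1 M p2 q2
    assume eP: "edges_of (k, p) = p1 @ M @ p2" and eQ: "edges_of (l, q) = q1 @ M @ q2"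
      and ne: "p1 \<noteq> []" "q1 \<noteq> []" "p2 \<noteq> []" "q2 \<noteq> []"
      and tgt: "edge_tgt s (last p1) = edge_tgt s (last q1)"
      and dl: "last p1 \<noteq> last q1" and dh: "hd p2 \<noteq> hd q2"
    have ends: "last p1 = (k + 1 - length p1, p (k + 1 - length p1))"
      "hd p2 = (k - length p1 - length M, p (k - length p1 - length M))"
      "length p1 + length M < k" "1 \<le> length p1"
      if "edges_of (k, p) = p1 @ M @ p2" "p1 \<noteq> []" "p2 \<noteq> []" for k p p1 p2
    proof -
      have len: "k = length p1 + length M + length p2"
        using arg_cong[OF that(1), of length] unfolding length_edges_of by simp
      have l: "1 \<le> length p1" "1 \<le> length p2" using that by (simp_all add: Suc_le_eq)
      then show "length p1 + length M < k" "1 \<le> length p1" using len by auto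
      have "last p1 = (p1 @ M @ p2) ! (length p1 - 1)"
        using that(2) by (simp add: last_conv_nth nth_append)
      then show "last p1 = (k + 1 - length p1, p (k + 1 - length p1))"
        using nth_edges_of[of "length p1 - 1" k p] that(1) len l by simp
      have "hd p2 = (p1 @ M @ p2) ! (length p1 + length M)"
        using that(3) by (simp add: hd_conv_nth nth_append)
      then show "hd p2 = (k - length p1 - length M, p (k - length p1 - length M))"
        using nth_edges_of[of "length p1 + length M" k p] that(1,3) len l
          by (simp del: nth_append_length_plus)
    qed
    note EP = ends[OF eP ne(1,3)] and EQ = ends[OF eQ ne(2,4)]
    define j where "j = k + 1 - length p1"
    have j: "j = l + 1 - length q1" using tgt EP EQ by (simp add: j_def)
    \<comment> \<open>Edge lists run from high to low indices, so the edge following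
      \<open>M\<close> has index \<open>j - 1 - length M\<close>.\<close>
    define i where "i = j - 1 - length M"
    have i: "k - length p1 - length M = i" "l - length q1 - length M = i"
      using EP EQ j by (auto simp: i_def j_def)
    have ij: "1 \<le> i" "i < j" "j \<le> k" "j \<le> l" using EP EQ i j by (auto simp: j_def)
    have e: "last p1 = (j, p j)" "last q1 = (j, q j)" "hd p2 = (i, p i)" "hd q2 = (i, q i)"
      using EP EQ i j j_def by auto
    have src: "edge_src s (i, p i) = edge_src s (i, q i)"
      using edge_src_rvec[OF P, of i] edge_src_rvec[OF Q, of i] ij by simp
    have "p j \<noteq> q j" "p i \<noteq> q i" using dl dh e by auto
    moreover from comp have "(p i \<le> q i \<and> p j \<le> q j) \<or> (q i \<le> p i \<and> q j \<le> p j)"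
      using ij by (auto simp: comparable_def)
    ultimately show "in_less s (last p1) (last q1) = out_less s (hd p2) (hd q2)"
      using src by (auto simp: e in_less_def out_less_def simp del: edge_src.simps)
  qed
next
  assume coh: "coherent s (edges_of (k, p)) (edges_of (l, q))"
  define N where "N = min k l"
  define opp where "opp i j \<longleftrightarrow> (p i < q i \<and> q j < p j) \<or> (q i < p i \<and> p j < q j)" for i j
  show "comparable (k, p) (l, q)"
  proof (rule ccontr)
    assume "\<not> comparable (k, p) (l, q)"
    then obtain a b where ab: "a \<in> {1..N}" "b \<in> {1..N}" "q a < p a" "p b < q b"
      unfolding comparable_def N_def fst_conv snd_conv by (meson not_le)
    define Pr where "Pr d \<longleftrightarrow> (\<exists>i j. 1 \<le> i \<and> i < j \<and> j \<le> N \<and> opp i j \<and> d = j - i)" for d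
    have "a \<noteq> b" using ab by auto
    then have "Pr (max a b - min a b)"
      unfolding Pr_def using ab
        by (intro exI[of _ "min a b"] exI[of _ "max a b"]) (auto simp: opp_def min_def max_def)
    then have "Pr (LEAST d. Pr d)" by (rule LeastI)
    then obtain i j where ij: "1 \<le> i" "i < j" "j \<le> N" "opp i j" "j - i = (LEAST d. Pr d)"
      by (auto simp: Pr_def)
    have mid: "p e = q e" if e: "i < e" "e < j" for e
    proof (rule ccontr)
      assume "p e \<noteq> q e"
      then have "opp i e \<or> opp e j" using ij(4) by (auto simp: opp_def)
      moreover have "1 \<le> e" "e \<le> N" using e ij(1,3) by auto
      ultimately have "Pr (e - i) \<or> Pr (j - e)" using e ij(1,3) unfolding Pr_def by blast
      then have "j - i \<le> e - i \<or> j - i \<le> j - e" unfolding ij(5)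
        by (auto intro: Least_le)
      then show False using e by auto
    qed
    have jk: "j \<le> k" "j \<le> l" using ij by (auto simp: N_def)
    let ?f = "\<lambda>i. (i, p i)" and ?g = "\<lambda>i. (i, q i)"
    have eq: "map ?f (rev [Suc i..<j]) = map ?g (rev [Suc i..<j])" using mid by auto
    have last: "last (map (\<lambda>i. (i, r i)) (rev [j..<Suc k])) = (j, r j)" if "j \<le> k" for k
      and r :: "nat \<Rightarrow> nat"
      using that by (subst last_map) (simp_all add: last_rev del: upt_Suc)
    have hd: "hd (map (\<lambda>i. (i, r i)) (rev [1..<Suc i])) = (i, r i)"
      for r :: "nat \<Rightarrow> nat"
      using ij by (subst hd_map) simp_all
    have src: "edge_src s (i, p i) = edge_src s (i, q i)"
      using edge_src_rvec[OF P, of i] edge_src_rvec[OF Q, of i] ij jk by simp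
    have "in_less s (j, p j) (j, q j) \<longleftrightarrow> out_less s (i, p i) (i, q i)"
      using coh[unfolded coherent_def, rule_format,
          of "map ?f (rev [j..<Suc k])" "map ?f (rev [Suc i..<j])" "map ?f (rev [1..<Suc i])"
            "map ?g (rev [j..<Suc l])" "map ?g (rev [1..<Suc i])"]
        edges_of_split[OF ij(1,2) jk(1), of p] edges_of_split[OF ij(1,2) jk(2), of q] eq
      unfolding last[OF jk(1)] last[OF jk(2)] hd using ij jk
        by (auto simp: opp_def simp del: upt_Suc)
    then show False using ij(4) src
      by (auto simp: opp_def in_less_def out_less_def simp del: edge_src.simps)
  qed
qed

end

section \<open>Regular triangulation and tropical cells\<close>

lemma lookup_scaleR:
  fixes x :: "'a \<Rightarrow>\<^sub>0 real"
  shows "Poly_Mapping.lookup (c *\<^sub>R x) i = c * Poly_Mapping.lookup x i"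
proof -
  have "finite {i. c *\<^sub>R Poly_Mapping.lookup x i \<noteq> 0}"
    by (rule finite_subset[OF _ finite_lookup[of x]]) auto
  then show ?thesis by (simp add: scaleR_poly_mapping_def)
qed

lemma linear_lookup_sum:
  fixes c :: "'a \<Rightarrow> real"
  shows "linear (\<lambda>v :: 'a \<Rightarrow>\<^sub>0 real. \<Sum>e\<in>E. Poly_Mapping.lookup v e * c e)"
  by (rule linearI)
    (simp_all add: lookup_add lookup_scaleR distrib_right sum.distrib sum_distrib_left mult.assoc)

text \<open>The weighted deficits \<open>M - g x\<close> are nonnegative and sum to 0, so only
  maximizers carry weight.\<close>

lemma convex_hull_max_face:
  fixes g :: "'a::real_vector \<Rightarrow> real"
  assumes "finite L" "linear g" "\<And>l. l \<in> L \<Longrightarrow> g l \<le> M"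
    "p \<in> convex hull L" "g p = M"
  shows "p \<in> convex hull {l \<in> L. g l = M}"
proof -
  interpret linear g by fact
  obtain u where u: "\<forall>x\<in>L. 0 \<le> u x" "sum u L = 1"
    "(\<Sum>x\<in>L. u x *\<^sub>R x) = p"
    using assms(4) unfolding convex_hull_finite[OF assms(1)] by blast
  let ?L = "{l \<in> L. g l = M}"
  have "M = (\<Sum>x\<in>L. u x * g x)" using assms(5) u(3) by (auto simp: sum scale)
  moreover have "M = (\<Sum>x\<in>L. u x * M)" using u(2) by (simp flip: sum_distrib_right)
  ultimately have "(\<Sum>x\<in>L. u x * (M - g x)) = 0"
    by (simp add: right_diff_distrib sum_subtractf)
  then have "\<forall>x\<in>L. u x * (M - g x) = 0"
    using assms(1,3) u(1) by (subst (asm) sum_nonneg_eq_0_iff) auto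
  then have zero: "u x = 0" if "x \<in> L - ?L" for x using that by fastforce
  have "sum u ?L = 1" using u(2) zero assms(1) by (subst sum.mono_neutral_left[of L]) auto
  moreover have "(\<Sum>x\<in>?L. u x *\<^sub>R x) = p"
    using u(3) zero assms(1) by (subst sum.mono_neutral_left[of L]) auto
  ultimately show ?thesis
    using assms(1) u(1) by (subst convex_hull_finite) (auto intro!: exI[of _ u])
qed

lemma lookup_route_vec: "Poly_Mapping.lookup (route_vec R) e = (if e \<in> set R then 1 else 0)"
proof -
  have "Poly_Mapping.lookup (route_vec R) e = (\<Sum>f\<in>set R. if f = e then 1 else 0)"
    by (simp add: route_vec_def lookup_sum lookup_single when_def)
  then show ?thesis by simp
qed

context comp_list
begin

lemma finite_routes: "finite (routes s)"
  by (simp add: routes_eq finite_rvecs)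

lemma routes_subset:
  "R \<in> routes s \<Longrightarrow> R' \<in> routes s \<Longrightarrow> set R \<subseteq> set R' \<Longrightarrow> R = R'"
  unfolding routes_eq using edges_of_subset by blast

text \<open>The number of edges shared with \<open>R\<close> is maximal only at \<open>R\<close>, which exposes its vertex.\<close>

definition overlap :: "edge list \<Rightarrow> (edge \<Rightarrow>\<^sub>0 real) \<Rightarrow> real" where
  "overlap R v = (\<Sum>e\<in>set R. Poly_Mapping.lookup v e)"

lemma linear_overlap: "linear (overlap R)"
  using linear_lookup_sum[where E = "set R" and c = "\<lambda>_. 1"]
    by (simp add: overlap_def[abs_def])

lemma overlap_route_vec: "overlap R (route_vec R') = real (card (set R \<inter> set R'))"
  by (simp add: overlap_def lookup_route_vec sum.If_cases Int_def)

lemma overlap_le: "overlap R (route_vec R') \<le> overlap R (route_vec R)"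
  by (simp add: overlap_route_vec card_mono)

lemma overlap_eq:
  assumes "R \<in> routes s" "R' \<in> routes s"
    "overlap R (route_vec R') = overlap R (route_vec R)"
  shows "R' = R"
proof -
  have "set R \<inter> set R' = set R"
    using assms(3) by (intro card_subset_eq) (auto simp: overlap_route_vec)
  then show ?thesis using routes_subset[OF assms(1,2)] by blast
qed

text \<open>This recovers the routes of a cell of the triangulation, which is given only as a set of
  points.\<close>

lemma route_vec_in_hull:
  assumes "R \<in> routes s" "K \<subseteq> routes s"
  shows "route_vec R \<in> convex hull (route_vec ` K) \<longleftrightarrow> R \<in> K"
proof
  assume "route_vec R \<in> convex hull (route_vec ` K)"
  then have "route_vec R \<in> convex hull {l \<in> route_vec ` K. overlap R l = overlap R (route_vec R)}"
    using finite_subset[OF assms(2) finite_routes] overlap_le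
    by (intro convex_hull_max_face linear_overlap) auto
  then have "{l \<in> route_vec ` K. overlap R l = overlap R (route_vec R)} \<noteq> {}"
    by (metis convex_hull_empty empty_iff)
  then show "R \<in> K" using overlap_eq[OF assms(1)] assms(2) by blast
qed (simp add: hull_inc)

text \<open>The functional \<open>overlap R\<close> also isolates the lift of \<open>R\<close> in
  the lifted polytope. Hence a face whose projection contains \<open>route_vec R\<close> contains
  the point at height \<open>h R\<close>.\<close>

lemma lifted_over_route:
  assumes "R \<in> routes s" "(route_vec R, y) \<in> lifted_polytope s h"
  shows "y = h R"
proof -
  let ?L = "(\<lambda>R. (route_vec R, h R)) ` routes s"
    and ?g = "\<lambda>p :: (edge \<Rightarrow>\<^sub>0 real) \<times> real. overlap R (fst p)"
  have "linear ?g" using linear_compose[OF linear_fst linear_overlap] by (simp add: o_def)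
  then have "(route_vec R, y) \<in> convex hull {l \<in> ?L. ?g l = overlap R (route_vec R)}"
    using assms(2) finite_routes overlap_le
    by (intro convex_hull_max_face) (auto simp: lifted_polytope_def)
  also have "{l \<in> ?L. ?g l = overlap R (route_vec R)} \<subseteq> {(route_vec R, h R)}"
    by (auto dest: overlap_eq[OF assms(1)])
  then have "convex hull {l \<in> ?L. ?g l = overlap R (route_vec R)} \<subseteq> convex hull {(route_vec R, h R)}"
    by (rule hull_mono)
  finally show ?thesis by simp
qed

definition min_routes :: "(edge list \<Rightarrow> real) \<Rightarrow> ((edge \<Rightarrow>\<^sub>0 real) \<Rightarrow> real) \<Rightarrow> edge list set" where
  "min_routes h \<phi> = {R \<in> routes s. \<forall>R'\<in>routes s. \<phi> (route_vec R) + h R \<le> \<phi> (route_vec R') + h R'}"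

lemma routes_ne: "routes s \<noteq> {}"
proof -
  have "(Suc (length s), \<lambda>i. if i = Suc (length s) then 1 else 0) \<in> rvecs"
    using m_top by (auto simp: rvecs_def)
  then show ?thesis by (auto simp: routes_eq)
qed

lemma min_routes_ne: "min_routes h \<phi> \<noteq> {}"
proof -
  let ?f = "\<lambda>R. \<phi> (route_vec R) + h R"
  have "Min (?f ` routes s) \<in> ?f ` routes s" using finite_routes routes_ne
    by (intro Min_in) auto
  then obtain R where R: "R \<in> routes s" "Min (?f ` routes s) = ?f R" by (rule imageE) auto
  have "?f R \<le> ?f R'" if "R' \<in> routes s" for R'
    using Min_le[of "?f ` routes s" "?f R'"] finite_routes that R(2) by simp
  then show ?thesis using R(1) by (auto simp: min_routes_def)
qed

text \<open>Faces are matched with sets of minimizing routes through the vertices in their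
  projections. This turns admissibility into a statement about route sets: minimizer sets are
  coherent, and every nonempty coherent set is a minimizer set.\<close>

lemma lower_face_routes:
  fixes \<phi> :: "(edge \<Rightarrow>\<^sub>0 real) \<Rightarrow> real"
    and h :: "edge list \<Rightarrow> real"
  assumes \<phi>: "linear \<phi>"
  defines "F \<equiv> {p \<in> lifted_polytope s h. \<forall>q\<in>lifted_polytope s h. \<phi> (fst p) + snd p \<le> \<phi> (fst q) + snd q}"
  shows "R \<in> routes s \<Longrightarrow> route_vec R \<in> fst ` F \<longleftrightarrow> R \<in> min_routes h \<phi>" and "F \<noteq> {}"
proof -
  have mem: "(route_vec R, h R) \<in> lifted_polytope s h" if "R \<in> routes s" for R
    unfolding lifted_polytope_def using that by (intro hull_inc) auto
  have min: "(route_vec R, h R) \<in> F" if R: "R \<in> min_routes h \<phi>" for R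
  proof -
    define M where "M = \<phi> (route_vec R) + h R"
    have lin: "linear (\<lambda>p :: (edge \<Rightarrow>\<^sub>0 real) \<times> real. \<phi> (fst p) + snd p)"
      using linear_compose[OF linear_fst \<phi>]
        by (intro linear_compose_add linear_snd) (simp add: o_def)
    have "lifted_polytope s h \<subseteq> (\<lambda>p. \<phi> (fst p) + snd p) -` {M..}"
      unfolding lifted_polytope_def
    proof (rule hull_minimal)
      show "(\<lambda>R. (route_vec R, h R)) ` routes s \<subseteq> (\<lambda>p. \<phi> (fst p) + snd p) -` {M..}"
        using R by (auto simp: min_routes_def M_def)
      show "convex ((\<lambda>p :: (edge \<Rightarrow>\<^sub>0 real) \<times> real. \<phi> (fst p) + snd p) -` {M..})"
        by (rule convex_linear_vimage[OF lin]) simp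
    qed
    then show ?thesis using mem[of R] R by (auto simp: F_def min_routes_def M_def)
  qed
  then show "F \<noteq> {}" using min_routes_ne by blast
  show "route_vec R \<in> fst ` F \<longleftrightarrow> R \<in> min_routes h \<phi>"
    if R: "R \<in> routes s"
  proof
    assume "route_vec R \<in> fst ` F"
    then obtain y where y: "(route_vec R, y) \<in> F" by auto
    then have "y = h R" using lifted_over_route[OF R] by (auto simp: F_def)
    then show "R \<in> min_routes h \<phi>"
      using y mem R by (fastforce simp: F_def min_routes_def)
  next
    assume "R \<in> min_routes h \<phi>"
    then show "route_vec R \<in> fst ` F" using min by force
  qed
qed

end

locale admissible = comp_list +
  fixes h :: "edge list \<Rightarrow> real" assumes adm: "admissible_height s h"
begin

lemma coherent_min_routes:
  assumes \<phi>: "linear \<phi>" and "P \<in> min_routes h \<phi>" "Q \<in> min_routes h \<phi>"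
  shows "coherent s P Q"
proof -
  define F where "F = {p \<in> lifted_polytope s h. \<forall>q\<in>lifted_polytope s h. \<phi> (fst p) + snd p \<le> \<phi> (fst q) + snd q}"
  note F = lower_face_routes[OF \<phi>, where h = h, folded F_def]
  have "F \<in> lower_faces (lifted_polytope s h)"
    unfolding lower_faces_def using F(2) \<phi> F_def by blast
  then have "fst ` F \<in> dkk_cells s"
    using adm unfolding admissible_height_def by blast
  then obtain K
    where K: "fst ` F = convex hull (route_vec ` K)" "K \<subseteq> routes s"
      "\<forall>P\<in>K. \<forall>Q\<in>K. coherent s P Q"
    unfolding dkk_cells_def by blast
  have "R \<in> K" if R: "R \<in> min_routes h \<phi>" for R
  proof -
    have "R \<in> routes s" using R by (simp add: min_routes_def)
    then show ?thesis using R F(1)[of R] K(1) route_vec_in_hull[OF _ K(2), of R] by simp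
  qed
  then show ?thesis using K(3) assms by blast
qed

lemma min_routes_of_coherent:
  assumes K: "K \<subseteq> routes s" "K \<noteq> {}"
    "\<forall>P\<in>K. \<forall>Q\<in>K. coherent s P Q"
  obtains \<phi> where "linear \<phi>" "min_routes h \<phi> = K"
proof -
  have "convex hull (route_vec ` K) \<in> dkk_cells s"
    unfolding dkk_cells_def using K by blast
  then obtain F
    where F: "F \<in> lower_faces (lifted_polytope s h)" "convex hull (route_vec ` K) = fst ` F"
    using adm unfolding admissible_height_def by auto
  then obtain \<phi> where \<phi>: "linear \<phi>"
    "F = {p \<in> lifted_polytope s h. \<forall>q\<in>lifted_polytope s h. \<phi> (fst p) + snd p \<le> \<phi> (fst q) + snd q}"
    unfolding lower_faces_def by blast
  have "R \<in> min_routes h \<phi> \<longleftrightarrow> R \<in> K" if "R \<in> routes s" for R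
    using lower_face_routes(1)[OF \<phi>(1) that,
      where h = h] \<phi>(2) F(2) route_vec_in_hull[OF that K(1)] by simp
  moreover have "min_routes h \<phi> \<subseteq> routes s" by (auto simp: min_routes_def)
  ultimately have "min_routes h \<phi> = K" using K(1) by blast
  then show thesis using that \<phi>(1) by blast
qed

section \<open>Tropical minimizers as cliques of routes\<close>

definition tval :: "(nat \<Rightarrow>\<^sub>0 real) \<Rightarrow> nat \<times> (nat \<Rightarrow> nat) \<Rightarrow> real" where
  "tval x P = h (edges_of P) + (\<Sum>i\<in>{1..<fst P}. if snd P i = 0 then 0 else Poly_Mapping.lookup x i)"

text \<open>Competitors share the source edge: minimality is taken within each tropical polynomial
  separately, and the minimizers of all of them are collected.\<close>

definition minset :: "(nat \<Rightarrow>\<^sub>0 real) \<Rightarrow> (nat \<times> (nat \<Rightarrow> nat)) set" where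
  "minset x = {(k, p) \<in> rvecs. \<forall>q. (k, q) \<in> rvecs \<and> q k = p k \<longrightarrow> tval x (k, p) \<le> tval x (k, q)}"

lemma minset_rvecs: "minset x \<subseteq> rvecs"
  by (auto simp: minset_def)

lemma trop_term_eq:
  assumes "(k, p) \<in> rvecs"
  shows "trop_term s h k (p k) x (delta_of k p) = tval x (k, p)"
proof -
  have "(\<Sum>i\<in>{1..<k}. real (delta_of k p i) * Poly_Mapping.lookup x i) =
      (\<Sum>i\<in>{1..<k}. if p i = 0 then 0 else Poly_Mapping.lookup x i)"
    by (rule sum.cong) (auto simp: delta_of_def)
  then show ?thesis by (simp add: trop_term_def tval_def edges_of_eq_route[OF assms])
qed

lemma finite_deltas: "finite (deltas k)"
  unfolding deltas_def by (rule finite_PiE) auto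

lemma trop_poly_le: "\<delta> \<in> deltas k \<Longrightarrow> trop_poly s h k t x \<le> trop_term s h k t x \<delta>"
  unfolding trop_poly_def using finite_deltas by (intro Min_le) auto

lemma trop_poly_ex: "\<exists>\<delta>\<in>deltas k. trop_term s h k t x \<delta> = trop_poly s h k t x"
proof -
  have "trop_poly s h k t x \<in> trop_term s h k t x ` deltas k"
    unfolding trop_poly_def using finite_deltas delta_of_deltas[of k] by (intro Min_in) auto
  then show ?thesis by force
qed

lemma mem_minset_iff:
  assumes p: "(k, p) \<in> rvecs"
  shows "(k, p) \<in> minset x \<longleftrightarrow> delta_of k p \<in> trop_minimizers s h k (p k) x"
proof -
  have k: "1 \<le> k" "k \<le> length s + 1" "1 \<le> p k" "p k \<le> spart s k - 1"
    using rvecsD(1-4)[OF p] by auto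
  obtain \<delta>
    where \<delta>: "\<delta> \<in> deltas k"
      "trop_term s h k (p k) x \<delta> = trop_poly s h k (p k) x"
    using trop_poly_ex by blast
  define q where "q = vec_of k (p k) \<delta>"
  have q: "(k, q) \<in> rvecs" "q k = p k" "delta_of k q = \<delta>"
    using vec_of_rvecs[OF k \<delta>(1)] delta_of_vec_of[OF k(1,2) \<delta>(1)]
      by (auto simp: q_def vec_of_def)
  have tq: "tval x (k, q) = trop_poly s h k (p k) x" using trop_term_eq[OF q(1), of x] q \<delta>
    by simp
  have le: "trop_poly s h k (p k) x \<le> tval x (k, q')" if "(k, q') \<in> rvecs" "q' k = p k"
    for q'
    using trop_poly_le[OF delta_of_deltas, of k "p k" x q'] trop_term_eq[OF that(1), of x] that(2)
      by simp
  have "(k, p) \<in> minset x \<longleftrightarrow> tval x (k, p) = trop_poly s h k (p k) x"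
  proof
    assume "(k, p) \<in> minset x"
    then have "tval x (k, p) \<le> tval x (k, q)" using q by (auto simp: minset_def)
    then show "tval x (k, p) = trop_poly s h k (p k) x" using tq le[OF p refl] by simp
  next
    assume "tval x (k, p) = trop_poly s h k (p k) x"
    then show "(k, p) \<in> minset x" using le p by (auto simp: minset_def)
  qed
  then show ?thesis using trop_term_eq[OF p, of x] delta_of_deltas
    by (simp add: trop_minimizers_def)
qed

lemma mem_minset_eq:
  assumes "(k, p) \<in> rvecs"
  shows "(k, p) \<in> minset x \<longleftrightarrow> tval x (k, p) = trop_poly s h k (p k) x"
    and "trop_poly s h k (p k) x \<le> tval x (k, p)"
  using mem_minset_iff[OF assms, of x] trop_term_eq[OF assms, of x] delta_of_deltas[of k p]
    trop_poly_le[OF delta_of_deltas, of k "p k" x p]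
  by (auto simp: trop_minimizers_def)

lemma full_minset: "full (minset x)"
  unfolding full_def
proof (intro allI impI, elim conjE)
  fix k t assume k: "1 \<le> k" "k \<le> Suc (length s)" "0 < t" "t < spart s k"
  obtain \<delta>
    where \<delta>: "\<delta> \<in> deltas k" "trop_term s h k t x \<delta> = trop_poly s h k t x"
    using trop_poly_ex by blast
  define p where "p = vec_of k t \<delta>"
  have p: "(k, p) \<in> rvecs" "p k = t" "delta_of k p = \<delta>"
    using vec_of_rvecs[of k t \<delta>] delta_of_vec_of[of k \<delta> t] k \<delta>(1)
      by (auto simp: p_def vec_of_def)
  then have "(k, p) \<in> minset x" using mem_minset_iff[OF p(1)] \<delta>
    by (simp add: trop_minimizers_def)
  then show "\<exists>p. (k, p) \<in> minset x \<and> p k = t" using p by blast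
qed

text \<open>The set \<open>minset\<close> also covers \<open>k = 1\<close>, where the arrangement
  has no polynomial: a route entering at 1 is the only one through its source edge and lies in every
  \<open>minset\<close>.\<close>

lemma trop_cell_eq: "trop_cell s h x = {y \<in> Rn (length s). minset x \<subseteq> minset y}"
proof -
  have "(\<forall>k t. 2 \<le> k \<and> k \<le> length s + 1 \<and> 1 \<le> t \<and> t \<le> spart s k - 1 \<longrightarrow>
      trop_minimizers s h k t x \<subseteq> trop_minimizers s h k t y) \<longleftrightarrow> minset x \<subseteq> minset y" (is "?A \<longleftrightarrow> _") for y
  proof
    assume A: ?A
    show "minset x \<subseteq> minset y"
    proof (rule subrelI)
      fix k p assume px: "(k, p) \<in> minset x"
      then have p: "(k, p) \<in> rvecs" using minset_rvecs by blast
      note pD = rvecsD(1-4)[OF p]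
      show "(k, p) \<in> minset y"
      proof (cases "k = 1")
        case True
        have "q = p" if "(k, q) \<in> rvecs" "q k = p k" for q
          by (rule rvecs_eqI[OF that(1) p]) (use that True in auto)
        then show ?thesis using p by (auto simp: minset_def)
      next
        case False
        then have "trop_minimizers s h k (p k) x \<subseteq> trop_minimizers s h k (p k) y"
          using A pD by auto
        then show ?thesis using mem_minset_iff[OF p] px by blast
      qed
    qed
  next
    assume sub: "minset x \<subseteq> minset y"
    show ?A
    proof (intro allI impI subsetI, elim conjE)
      fix k t \<delta> assume k: "2 \<le> k" "k \<le> length s + 1" "1 \<le> t"
        "t \<le> spart s k - 1"
        and \<delta>: "\<delta> \<in> trop_minimizers s h k t x"
      have d: "\<delta> \<in> deltas k" using \<delta> by (simp add: trop_minimizers_def)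
      define p where "p = vec_of k t \<delta>"
      have p: "(k, p) \<in> rvecs" "p k = t" "delta_of k p = \<delta>"
        using vec_of_rvecs[of k t \<delta>] delta_of_vec_of[of k \<delta> t] k d
          by (auto simp: p_def vec_of_def)
      then show "\<delta> \<in> trop_minimizers s h k t y"
        using mem_minset_iff[OF p(1), of x] mem_minset_iff[OF p(1), of y] sub \<delta> by auto
    qed
  qed
  then show ?thesis by (simp add: trop_cell_def)
qed

lemma linear_route_value:
  assumes "linear \<phi>" "(k, p) \<in> rvecs"
  shows "\<phi> (route_vec (edges_of (k, p))) = (\<Sum>i\<in>{1..k}. \<phi> (Poly_Mapping.single (i, p i) 1))"
proof -
  interpret linear \<phi> by fact
  have "\<phi> (route_vec (edges_of (k, p))) = (\<Sum>e\<in>(\<lambda>i. (i, p i)) ` {1..k}. \<phi> (Poly_Mapping.single e 1))"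
    by (simp add: route_vec_def set_edges_of sum)
  also have "\<dots> = (\<Sum>i\<in>{1..k}. \<phi> (Poly_Mapping.single (i, p i) 1))"
    by (subst sum.reindex) (auto intro: inj_onI)
  finally show ?thesis .
qed

text \<open>
  A point \<open>x\<close> of the arrangement is turned into a functional on edges: \<open>x\<^sub>i\<close> on the dip at \<open>i\<close>, and
  the negated tropical value on each source edge, so that all source edges carry minimal routes.
\<close>

lemma clique_minset: "clique (minset x)"
  unfolding clique_def
proof (intro conjI ballI)
  show "minset x \<subseteq> rvecs" by (rule minset_rvecs)
  define c where "c e = (if snd e = 0 then 0 else if snd e = spart s (fst e) then Poly_Mapping.lookup x (fst e)
    else - trop_poly s h (fst e) (snd e) x)" for e :: edge
  define E where "E = (\<Union>R\<in>routes s. set R)"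
  have finE: "finite E" using finite_routes by (simp add: E_def)
  define \<phi> where "\<phi> v = (\<Sum>e\<in>E. Poly_Mapping.lookup v e * c e)"
    for v :: "edge \<Rightarrow>\<^sub>0 real"
  have lin: "linear \<phi>" using linear_lookup_sum[where E = E and c = c]
    by (simp add: \<phi>_def[abs_def])
  have val_eq: "\<phi> (route_vec (edges_of (k, p))) + h (edges_of (k, p)) = tval x (k, p) - trop_poly s h k (p k) x"
    if p: "(k, p) \<in> rvecs" for k p
  proof -
    have single: "\<phi> (Poly_Mapping.single (i, p i) 1) = c (i, p i)" if "i \<in> {1..k}" for i
    proof -
      have "(i, p i) \<in> E" unfolding E_def routes_eq
        by (rule UN_I[OF imageI[OF p]]) (use that in \<open>auto simp: set_edges_of\<close>)
      have "\<phi> (Poly_Mapping.single (i, p i) 1) = (\<Sum>e\<in>E. if e = (i, p i) then c e else 0)"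
        unfolding \<phi>_def by (rule sum.cong) (auto simp: lookup_single when_def)
      then show ?thesis using finE \<open>(i, p i) \<in> E\<close> by simp
    qed
    have "(\<Sum>i\<in>{1..k}. \<phi> (Poly_Mapping.single (i, p i) 1)) = (\<Sum>i\<in>{1..k}. c (i, p i))"
      by (rule sum.cong) (use single in auto)
    also have "(\<Sum>i\<in>{1..k}. c (i, p i)) = c (k, p k) + (\<Sum>i\<in>{1..<k}. c (i, p i))"
    proof -
      have "{1..k} = insert k {1..<k}" using rvecsD(1)[OF p] by auto
      then show ?thesis by simp
    qed
    also have "(\<Sum>i\<in>{1..<k}. c (i, p i)) = (\<Sum>i\<in>{1..<k}. if p i = 0 then 0 else Poly_Mapping.lookup x i)"
    proof (rule sum.cong)
      fix i assume "i \<in> {1..<k}"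
      then have "p i = 0 \<or> p i = spart s i" using rvecsD(5)[OF p, of i] by simp
      then show "c (i, p i) = (if p i = 0 then 0 else Poly_Mapping.lookup x i)"
        by (auto simp: c_def)
    qed simp
    also have "c (k, p k) = - trop_poly s h k (p k) x" using rvecsD(3,4)[OF p] by (simp add: c_def)
    finally show ?thesis using linear_route_value[OF lin p] by (simp add: tval_def)
  qed
  have min: "edges_of (k, p) \<in> min_routes h \<phi>" if kp: "(k, p) \<in> minset x" for k p
  proof -
    have p: "(k, p) \<in> rvecs" using kp minset_rvecs by blast
    have "\<phi> (route_vec (edges_of (k, p))) + h (edges_of (k, p)) = 0"
      using val_eq[OF p] mem_minset_eq(1)[OF p, of x] kp by simp
    moreover have "0 \<le> \<phi> (route_vec (edges_of (l, q))) + h (edges_of (l, q))"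
      if "(l, q) \<in> rvecs" for l q
      using val_eq[OF that] mem_minset_eq(2)[OF that, of x] by simp
    ultimately show ?thesis using p by (auto simp: min_routes_def routes_eq)
  qed
  fix P Q assume PQ: "P \<in> minset x" "Q \<in> minset x"
  obtain k p l q where e: "P = (k, p)" "Q = (l, q)" by (cases P, cases Q)
  have "coherent s (edges_of P) (edges_of Q)"
    using coherent_min_routes[OF lin] min PQ e by blast
  then show "comparable P Q"
    using coherent_iff_comparable PQ e minset_rvecs by blast
qed

text \<open>A functional with minimizer set \<open>K\<close> yields \<open>x\<close> by taking, at
  each \<open>i\<close>, its value on the dip minus its value on the bump. On routes with a common
  source edge, \<open>val\<close> and \<open>tval x\<close> differ by a constant. Since
  \<open>K\<close> meets every source edge, the minimizers for each source edge are already global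
  minimizers.\<close>

lemma minset_surj:
  assumes K: "interior_clique K"
  obtains x where "x \<in> Rn (length s)" "minset x = K"
proof -
  interpret interior "length s" "spart s" K by unfold_locales fact
  have KR: "K \<subseteq> rvecs" using K_rvecs by auto
  obtain k0 p0 where k0: "(k0, p0) \<in> K" using hit[of "Suc (length s)" 1] m_top by auto
  have "\<forall>P\<in>edges_of ` K. \<forall>Q\<in>edges_of ` K. coherent s P Q"
  proof (intro ballI, elim imageE)
    fix R R' P Q assume a: "R = edges_of P" "P \<in> K" "R' = edges_of Q" "Q \<in> K"
    obtain k p l q where e: "P = (k, p)" "Q = (l, q)" by (cases P, cases Q)
    have "comparable P Q" using K a by (simp add: interior_clique_def clique_def)
    then show "coherent s R R'" using coherent_iff_comparable[of k p l q] K_rvecs a e by simp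
  qed
  then obtain \<phi> where \<phi>: "linear \<phi>" "min_routes h \<phi> = edges_of ` K"
    using min_routes_of_coherent[of "edges_of ` K"] KR k0 routes_eq
      by (metis empty_iff image_is_empty image_mono)
  define val where "val P = \<phi> (route_vec (edges_of P)) + h (edges_of P)" for P
  have K_iff: "P \<in> K \<longleftrightarrow> (\<forall>Q\<in>rvecs. val P \<le> val Q)"
    if "P \<in> rvecs" for P
  proof -
    have "edges_of P \<in> min_routes h \<phi> \<longleftrightarrow> P \<in> K"
      unfolding \<phi>(2) using inj_on_edges_of KR that by (auto simp: inj_on_image_mem_iff)
    then show ?thesis using that by (auto simp: min_routes_def routes_eq val_def)
  qed
  define sg where "sg e = \<phi> (Poly_Mapping.single e 1)" for e
  define x where "x = (\<Sum>i\<in>{1..length s}. Poly_Mapping.single i (sg (i, spart s i) - sg (i, 0)))"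
  have xl: "Poly_Mapping.lookup x i = sg (i, spart s i) - sg (i, 0)"
    if "1 \<le> i" "i \<le> length s" for i
  proof -
    have "Poly_Mapping.lookup x i = (\<Sum>j\<in>{1..length s}. if j = i then sg (j, spart s j) - sg (j, 0) else 0)"
      unfolding x_def by (simp add: lookup_sum lookup_single when_def)
    then show ?thesis using that by simp
  qed
  have "Poly_Mapping.keys x \<subseteq> {1..length s}"
    unfolding x_def by (rule subset_trans[OF keys_sum]) (auto split: if_splits)
  then have xR: "x \<in> Rn (length s)" by (simp add: Rn_def)
  have val_eq: "val (k, p) = (sg (k, p k) + (\<Sum>i\<in>{1..<k}. sg (i, 0))) + tval x (k, p)"
    if p: "(k, p) \<in> rvecs" for k p
  proof -
    have "(\<Sum>i\<in>{1..k}. sg (i, p i)) = sg (k, p k) + (\<Sum>i\<in>{1..<k}. sg (i, p i))"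
    proof -
      have "{1..k} = insert k {1..<k}" using rvecsD(1)[OF p] by auto
      then show ?thesis by simp
    qed
    also have "(\<Sum>i\<in>{1..<k}. sg (i, p i)) =
        (\<Sum>i\<in>{1..<k}. sg (i, 0) + (if p i = 0 then 0 else Poly_Mapping.lookup x i))"
    proof (rule sum.cong)
      fix i assume i: "i \<in> {1..<k}"
      then show "sg (i, p i) = sg (i, 0) + (if p i = 0 then 0 else Poly_Mapping.lookup x i)"
        using rvecsD(5)[OF p, of i] rvecsD(2)[OF p] xl[of i] by auto
    qed simp
    finally show ?thesis
      using linear_route_value[OF \<phi>(1) p] by (simp add: val_def tval_def sg_def sum.distrib)
  qed
  have "(k, p) \<in> minset x \<longleftrightarrow> (k, p) \<in> K" if p: "(k, p) \<in> rvecs"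
    for k p
  proof
    assume min: "(k, p) \<in> minset x"
    obtain q where q: "(k, q) \<in> K" "q k = p k" using hit[of k "p k"] rvecsD(1-4)[OF p] by auto
    have "tval x (k, p) \<le> tval x (k, q)" using min q K_rvecs by (auto simp: minset_def)
    then have "val (k, p) \<le> val (k, q)" using val_eq[OF p] val_eq[OF K_rvecs[OF q(1)]] q(2)
      by simp
    then show "(k, p) \<in> K" using K_iff[OF p] K_iff[OF K_rvecs[OF q(1)]] q(1)
      by (meson order_trans)
  next
    assume "(k, p) \<in> K"
    then have le: "val (k, p) \<le> val (k, q)" if "(k, q) \<in> rvecs" for q using K_iff[OF p] that
      by blast
    have "tval x (k, p) \<le> tval x (k, q)" if "(k, q) \<in> rvecs" "q k = p k" for q
      using le[OF that(1)] val_eq[OF p] val_eq[OF that(1)] that(2) by simp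
    then show "(k, p) \<in> minset x" using p by (simp add: minset_def)
  qed
  then have "minset x = K" using minset_rvecs[of x] KR by auto
  then show thesis using that xR by blast
qed

section \<open>Boundedness of cells\<close>

lemma tval_add_single:
  assumes "a \<in> {1..length s}"
  shows "tval (x + Poly_Mapping.single a d) (k, q) = tval x (k, q) + (if a < k \<and> q a \<noteq> 0 then d else 0)"
proof -
  have "(\<Sum>i\<in>{1..<k}. if q i = 0 then 0 else Poly_Mapping.lookup (x + Poly_Mapping.single a d) i) =
    (\<Sum>i\<in>{1..<k}. (if q i = 0 then 0 else Poly_Mapping.lookup x i) + (if i = a then (if q a \<noteq> 0 then d else 0) else 0))"
    by (rule sum.cong) (auto simp: lookup_add lookup_single when_def)
  also have "\<dots> = (\<Sum>i\<in>{1..<k}. if q i = 0 then 0 else Poly_Mapping.lookup x i) + (if a < k \<and> q a \<noteq> 0 then d else 0)"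
    using assms by (simp add: sum.distrib)
  finally show ?thesis by (simp add: tval_def)
qed

lemma unbounded_line:
  assumes a: "a \<in> {1..length s}" and e: "e = 1 \<or> e = (-1::real)"
    and all: "\<And>d. 0 \<le> d \<Longrightarrow> x + Poly_Mapping.single a (e * d) \<in> C"
  shows "\<not> bounded C"
proof
  assume "bounded C"
  then obtain B where B: "\<And>y. y \<in> C \<Longrightarrow> norm y \<le> B"
    by (auto simp: bounded_iff)
  let ?v = "Poly_Mapping.single a (1::real)"
  have v: "0 < norm ?v" unfolding zero_less_norm_iff
    by (metis lookup_single_eq lookup_zero zero_neq_one)
  have sc: "Poly_Mapping.single a (e * d) = (e * d) *\<^sub>R ?v" for d
    by (rule poly_mapping_eqI) (simp add: lookup_scaleR lookup_single when_def)
  define d where "d = (B + norm x + 1) / norm ?v"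
  have "0 \<le> B" using B[OF all[of 0]] norm_ge_zero order_trans by blast
  then have d: "0 \<le> d" by (simp add: d_def)
  have "B + norm x + 1 = norm ((e * d) *\<^sub>R ?v)" using e d v \<open>0 \<le> B\<close>
    by (auto simp: d_def abs_mult)
  also have "\<dots> \<le> norm (x + (e * d) *\<^sub>R ?v) + norm x"
    using norm_triangle_ineq4[of "x + (e * d) *\<^sub>R ?v" x] by simp
  also have "\<dots> \<le> B + norm x" using B[OF all[OF d]] sc by simp
  finally show False by simp
qed

lemma Rn_add_single: "x \<in> Rn n \<Longrightarrow> a \<in> {1..n} \<Longrightarrow> x + Poly_Mapping.single a d \<in> Rn n"
  using keys_add[of x "Poly_Mapping.single a d"] by (auto simp: Rn_def split: if_splits)

text \<open>If no minimal route takes the bump at \<open>a\<close>, every minimal route passing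
  \<open>a\<close> has the \<open>a\<close>-th coordinate in its term. Decreasing this coordinate
  lowers such terms at least as much as any competitor, so the cell contains a ray. A missing dip
  gives a ray in the opposite direction.\<close>

lemma interior_if_bounded:
  assumes x: "x \<in> Rn (length s)" and b: "bounded (trop_cell s h x)"
  shows "interior_clique (minset x)"
  unfolding interior_clique_def
proof (intro conjI ballI clique_minset full_minset)
  fix a assume a: "a \<in> {1..length s}"
  show "\<exists>k p. (k, p) \<in> minset x \<and> a < k \<and> p a = 0"
  proof (rule ccontr)
    assume no: "\<not> ?thesis"
    have "x + Poly_Mapping.single a (-1 * d) \<in> trop_cell s h x" if d: "0 \<le> d" for d
      unfolding trop_cell_eq
    proof (intro CollectI conjI Rn_add_single[OF x a] subrelI)
      fix k p assume p: "(k, p) \<in> minset x"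
      have "tval x (k, p) \<le> tval x (k, q)" if "(k, q) \<in> rvecs" "q k = p k" for q
        using p that by (auto simp: minset_def)
      moreover have "p a \<noteq> 0" if "a < k" using no p that by metis
      moreover have "(k, p) \<in> rvecs" using p minset_rvecs by blast
      ultimately show "(k, p) \<in> minset (x + Poly_Mapping.single a (-1 * d))"
        using d unfolding minset_def by (auto simp: tval_add_single[OF a]) (smt (verit))+
    qed
    then show False using unbounded_line[OF a, of "-1" x] b by blast
  qed
  show "\<exists>k p. (k, p) \<in> minset x \<and> a < k \<and> p a = spart s a"
  proof (rule ccontr)
    assume no: "\<not> ?thesis"
    have "x + Poly_Mapping.single a (1 * d) \<in> trop_cell s h x" if d: "0 \<le> d" for d
      unfolding trop_cell_eq
    proof (intro CollectI conjI Rn_add_single[OF x a] subrelI)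
      fix k p assume p: "(k, p) \<in> minset x"
      have r: "(k, p) \<in> rvecs" using p minset_rvecs by blast
      have "tval x (k, p) \<le> tval x (k, q)" if "(k, q) \<in> rvecs" "q k = p k" for q
        using p that by (auto simp: minset_def)
      moreover have "p a = 0" if "a < k" using no p rvecsD(5)[OF r, of a] a that by auto
      ultimately show "(k, p) \<in> minset (x + Poly_Mapping.single a (1 * d))"
        using r d unfolding minset_def by (auto simp: tval_add_single[OF a]) (smt (verit))+
    qed
    then show False using unbounded_line[OF a, of "1" x] b by blast
  qed
qed

lemma rvecs_update:
  assumes "(k, p) \<in> rvecs" "1 \<le> a" "a < k" "v = 0 \<or> v = spart s a"
  shows "(k, p(a := v)) \<in> rvecs"
  using assms by (auto simp: rvecs_def)

lemma tval_update:
  assumes "1 \<le> a" "a < k" "p a = 0" "v \<noteq> 0"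
  shows "tval y (k, p(a := v)) - tval y (k, p) =
    h (edges_of (k, p(a := v))) - h (edges_of (k, p)) + Poly_Mapping.lookup y a"
proof -
  let ?f = "\<lambda>p i. if p i = (0::nat) then 0 else Poly_Mapping.lookup y i"
  have "(\<Sum>i\<in>{1..<k}. ?f (p(a := v)) i) = ?f (p(a := v)) a + (\<Sum>i\<in>{1..<k} - {a}. ?f (p(a := v)) i)"
    using assms by (intro sum.remove) auto
  also have "(\<Sum>i\<in>{1..<k} - {a}. ?f (p(a := v)) i) = (\<Sum>i\<in>{1..<k} - {a}. ?f p i)"
    by (rule sum.cong) auto
  also have "(\<Sum>i\<in>{1..<k} - {a}. ?f p i) = (\<Sum>i\<in>{1..<k}. ?f p i) - ?f p a"
    using assms by (subst sum.remove[of "{1..<k}" a]) auto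
  finally show ?thesis using assms by (simp add: tval_def)
qed

text \<open>Exchanging bump and dip at \<open>a\<close> changes the value of a route by the
  \<open>a\<close>-th coordinate, up to sign, and a difference of heights. A minimal route through
  the bump thus bounds the coordinate from below, one through the dip from above. The bounds are
  uniform because both routes stay minimal on the whole cell.\<close>

lemma bounded_if_interior:
  assumes K: "interior_clique (minset x)"
  shows "bounded (trop_cell s h x)"
proof -
  interpret interior "length s" "spart s" "minset x" by unfold_locales fact
  have "\<exists>B. \<forall>y\<in>trop_cell s h x. \<bar>Poly_Mapping.lookup y a\<bar> \<le> B"
    if a: "a \<in> {1..length s}" for a
  proof -
    have ma: "spart s a \<noteq> 0" using m_pos[of a] a by simp
    obtain k p where p: "(k, p) \<in> minset x" "a < k" "p a = 0" using bump_used[of a] a by auto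
    obtain l q where q: "(l, q) \<in> minset x" "a < l" "q a = spart s a" using dip_used[of a] a
      by auto
    define p' where "p' = p(a := spart s a)"
    define q' where "q' = q(a := 0)"
    have p': "(k, p') \<in> rvecs" "p' k = p k" using rvecs_update[OF K_rvecs[OF p(1)]] p a
      by (auto simp: p'_def)
    have q': "(l, q') \<in> rvecs" "q' l = q l" using rvecs_update[OF K_rvecs[OF q(1)]] q a
      by (auto simp: q'_def)
    have qq: "q = q'(a := spart s a)" using q by (auto simp: q'_def)
    have "\<bar>Poly_Mapping.lookup y a\<bar> \<le> \<bar>h (edges_of (k, p')) - h (edges_of (k, p))\<bar> + \<bar>h (edges_of (l, q)) - h (edges_of (l, q'))\<bar>"
      if y: "y \<in> trop_cell s h x" for y
    proof -
      have "(k, p) \<in> minset y" "(l, q) \<in> minset y" using y p q by (auto simp: trop_cell_eq)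
      then have "tval y (k, p) \<le> tval y (k, p')" "tval y (l, q) \<le> tval y (l, q')"
        using p' q' by (auto simp: minset_def)
      moreover have "tval y (k, p') - tval y (k, p) = h (edges_of (k, p')) - h (edges_of (k, p)) + Poly_Mapping.lookup y a"
        unfolding p'_def using p a ma by (intro tval_update) auto
      moreover have "tval y (l, q) - tval y (l, q') = h (edges_of (l, q)) - h (edges_of (l, q')) + Poly_Mapping.lookup y a"
        using tval_update[of a l q' "spart s a" y, folded qq] q a ma by (simp add: q'_def)
      ultimately show ?thesis by linarith
    qed
    then show ?thesis by blast
  qed
  then obtain B
    where B: "\<And>a y. a \<in> {1..length s} \<Longrightarrow> y \<in> trop_cell s h x \<Longrightarrow> \<bar>Poly_Mapping.lookup y a\<bar> \<le> B a"
    by metis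
  show ?thesis
    unfolding bounded_iff
  proof (intro exI ballI)
    fix y assume y: "y \<in> trop_cell s h x"
    then have keys: "Poly_Mapping.keys y \<subseteq> {1..length s}"
      by (simp add: trop_cell_eq Rn_def)
    \<comment> \<open>The norm of a finitely supported function is the sum of its absolute values,
      so coordinatewise bounds suffice.\<close>
    have "norm y = (\<Sum>i\<in>Poly_Mapping.keys y. \<bar>Poly_Mapping.lookup y i\<bar>)"
      by (simp add: norm_poly_mapping_def dist_poly_mapping_def)
    also have "\<dots> \<le> (\<Sum>i\<in>{1..length s}. \<bar>Poly_Mapping.lookup y i\<bar>)"
      using keys by (intro sum_mono2) auto
    also have "\<dots> \<le> (\<Sum>i\<in>{1..length s}. B i)" using B y by (intro sum_mono) auto
    finally show "norm y \<le> (\<Sum>i\<in>{1..length s}. B i)" .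
  qed
qed

lemma cell_subset_iff:
  assumes "x \<in> Rn (length s)" "y \<in> Rn (length s)"
  shows "trop_cell s h x \<subseteq> trop_cell s h y \<longleftrightarrow> minset y \<subseteq> minset x"
  using assms by (auto simp: trop_cell_eq)

text \<open>Intersecting over the whole cell avoids choosing a point: \<open>x\<close> lies in its
  own cell, and all other points of the cell have at least the minimizers of
  \<open>x\<close>.\<close>

definition cell_clique :: "(nat \<Rightarrow>\<^sub>0 real) set \<Rightarrow> (nat \<times> (nat \<Rightarrow> nat)) set" where
  "cell_clique C = (\<Inter>y\<in>C. minset y)"

lemma cell_clique_cell: "x \<in> Rn (length s) \<Longrightarrow> cell_clique (trop_cell s h x) = minset x"
  by (auto simp: cell_clique_def trop_cell_eq)

lemma bounded_cellE:
  assumes "C \<in> bounded_cells s h"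
  obtains x where "x \<in> Rn (length s)" "C = trop_cell s h x" "interior_clique (minset x)"
    "cell_clique C = minset x"
  using assms interior_if_bounded cell_clique_cell unfolding bounded_cells_def by auto

lemma bij_betw_cell_clique: "bij_betw cell_clique (bounded_cells s h) {K. interior_clique K}"
  unfolding bij_betw_def
proof (intro conjI equalityI subsetI)
  show "inj_on cell_clique (bounded_cells s h)"
  proof (rule inj_onI)
    fix C D assume CD: "C \<in> bounded_cells s h" "D \<in> bounded_cells s h"
      "cell_clique C = cell_clique D"
    obtain x where x: "C = trop_cell s h x" "cell_clique C = minset x" using CD(1)
      by (rule bounded_cellE)
    obtain y where y: "D = trop_cell s h y" "cell_clique D = minset y" using CD(2)
      by (rule bounded_cellE)
    show "C = D" using x y CD(3) by (simp add: trop_cell_eq)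
  qed
  show "K \<in> {K. interior_clique K}" if K: "K \<in> cell_clique ` bounded_cells s h" for K
  proof -
    obtain C where C: "C \<in> bounded_cells s h" "K = cell_clique C" using K by blast
    obtain x where "interior_clique (minset x)" "cell_clique C = minset x" using C(1)
      by (rule bounded_cellE)
    then show ?thesis using C(2) by simp
  qed
  show "K \<in> cell_clique ` bounded_cells s h" if K: "K \<in> {K. interior_clique K}" for K
  proof -
    obtain x where x: "x \<in> Rn (length s)" "minset x = K" using minset_surj[of K] K by blast
    then have "trop_cell s h x \<in> bounded_cells s h"
      using bounded_if_interior[of x] K by (simp add: bounded_cells_def)
    then show ?thesis using cell_clique_cell[OF x(1)] x(2) by blast
  qed
qed

end

theorem theorem5p10:
  fixes s :: "nat list" and h :: "edge list \<Rightarrow> real"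
  assumes "composition s"
    and "admissible_height s h"
  shows "poset_isomorphic (bounded_cells s h) (\<subseteq>) (perm_faces s) (perm_face_le s)"
proof -
  interpret admissible s h by unfold_locales fact+
  have "bij_betw (clique_face \<circ> cell_clique) (bounded_cells s h) (perm_faces s)"
    using bij_betw_trans[OF bij_betw_cell_clique bij_betw_clique_face] .
  moreover have "C \<subseteq> D \<longleftrightarrow> perm_face_le s ((clique_face \<circ> cell_clique) C) ((clique_face \<circ> cell_clique) D)"
    if CD: "C \<in> bounded_cells s h" "D \<in> bounded_cells s h" for C D
  proof -
    obtain x where x: "x \<in> Rn (length s)" "C = trop_cell s h x" "interior_clique (minset x)"
      "cell_clique C = minset x"
      using CD(1) by (rule bounded_cellE)
    obtain y where y: "y \<in> Rn (length s)" "D = trop_cell s h y" "interior_clique (minset y)"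
      "cell_clique D = minset y"
      using CD(2) by (rule bounded_cellE)
    \<comment> \<open>Both correspondences reverse inclusion, so their composite preserves the
      order.\<close>
    show ?thesis using cell_subset_iff[OF x(1) y(1)] clique_face_le_iff[OF x(3) y(3)] x y by simp
  qed
  ultimately show ?thesis unfolding poset_isomorphic_def by blast
qed

end
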